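(* Let $A$ be a $3\times 3$ matrix defining a generalized rolling constraint, of rank $j\in\{0,1,2,3\}$. Let $\{\cdot,\cdot\}_{\mathrm{nh}}^B$ be the bracket on the constraint manifold $\mathcal{M}$ obtained from the nonholonomic bracket of the rigid body subject to $\dot{\mathbf x}=rA\omega$ by the gauge transformation by the 2-form $B=-mr^2\,\Omega\cdot d\lambda$ on $\mathcal{M}$. Let $\{\cdot,\cdot\}_{\mathrm{red}^B}$ be the reduced bracket on $\mathcal{R}=\mathcal{M}/H\cong S^2\times\mathbb{R}^3$, characterized by $\{f_1,f_2\}_{\mathrm{red}^B}\circ\rho=\{f_1\circ\rho,f_2\circ\rho\}^B_{\mathrm{nh}}$ for $f_1,f_2\in C^\infty(\mathcal{R})$. Then $\{\cdot,\cdot\}_{\mathrm{red}^B}$ is precisely the restriction to the Casimir level set $\|\gamma\|=1$ of the bracket $$\{f_1,f_2\}'_{\mathrm{Rank}j}=-N'_j\cdot\left(\frac{\partial f_1}{\partial K}\times\frac{\partial f_2}{\partial K}\right)-\gamma\cdot\left(\frac{\partial f_1}{\partial K}\times\frac{\partial f_2}{\partial\gamma}-\frac{\partial f_2}{\partial K}\times\frac{\partial f_1}{\partial\gamma}\right),$$ where $N'_0=K-mr^2\Omega$, $N'_1=K-mr^2\Omega+mr^2(\Omega\cdot\gamma)\gamma$, $N'_2=K-mr^2(\Omega\cdot\gamma)\gamma$, $N'_3=K$.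
   Context: Generalized rolling constraint: $A=\begin{pmatrix}C&0\\0&1\end{pmatrix}$, $C\in SO(2)$ (rank 3); $A=\begin{pmatrix}C&0\\0&0\end{pmatrix}$, $C\in SO(2)$ (rank 2); $A=e_3e_3^T$ (rank 1); or $A=0$ (rank 0). System: $Q=SO(3)\times\mathbb{R}^3\ni(g,\mathbf{x})$; $m,r>0$; $\mathbb{I}=\mathrm{diag}(I_1,I_2,I_3)$ with positive entries. Identify $\mathfrak{so}(3)\cong\mathbb{R}^3$ by the hat map; $\hat\omega=\dot gg^{-1}$, $\hat\Omega=g^{-1}\dot g$, so $\omega=g\Omega$. The Lagrangian is $\mathcal{L}=\frac12(\mathbb{I}\Omega)\cdot\Omega+\frac m2\|\dot{\mathbf x}\|^2$. The constraint distribution $\mathcal{D}\subset TQ$ is $\dot{\mathbf x}=rAg\Omega$, the annihilator of the $\mathbb{R}^3$-valued 1-form $\epsilon=d\mathbf{x}-rAg\lambda$, where $\lambda$ is the ($\mathbb{R}^3$-valued) left Maurer–Cartan form on $SO(3)$, so that $d\lambda=-\frac12\lambda\times\lambda$, i.e. $d\lambda_1=-\lambda_2\wedge\lambda_3$ and cyclic permutations. Nonholonomic bivector: $\mathcal{M}=\mathrm{Leg}(\mathcal{D})\subset T^*Q$ (image under the Legendre transform), $\Omega_Q=-d\Theta$ is the canonical 2-form of $T^*Q$ ($\sum dq^i\wedge dp_i$), $\tau:T^*Q\to Q$, $\mathcal{C}=T\mathcal{M}\cap\{v:\langle\tau^*\epsilon,v\rangle=0\}$, and $\Omega_{\mathcal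 C}$ is the restriction of $\Omega_Q$ to $\mathcal{C}$, which is nondegenerate. The nonholonomic bivector field $\pi_{\mathrm{nh}}$ on $\mathcal{M}$ is given by $\pi_{\mathrm{nh}}^\sharp(\alpha)=-X$ iff $X\in\Gamma(\mathcal{C})$ and $\mathbf{i}_X\Omega_{\mathcal C}=\alpha|_{\mathcal C}$. Convention: $\beta(\pi^\sharp(\alpha))=\pi(\alpha,\beta)$, $\{f_1,f_2\}=\pi(df_1,df_2)$. Points of $\mathcal{M}$ are parametrized by $(g,\mathbf{x},K)\in SO(3)\times\mathbb{R}^3\times\mathbb{R}^3$, where $K=\mathbb{I}\Omega+mr^2g^{-1}A^TAg\,\Omega$; via this relation $\Omega$ is a function on $\mathcal{M}$, and $\lambda$ is pulled back to $\mathcal{M}$. Gauge transformation: the gauged bivector field $\pi^B_{\mathrm{nh}}$ is the one whose graph $\{((\pi_{\mathrm{nh}}^B)^\sharp(\beta),\beta)\}$ is $\{(X,\alpha+\mathbf{i}_XB):X=\pi_{\mathrm{nh}}^\sharp(\alpha)\}$; equivalently it is the bivector defined by $(\mathcal{C},(\Omega_Q-B)|_{\mathcal C})$ in place of $(\mathcal{C},\Omega_{\mathcal C})$. Reduction: $H=\{(h,y)\in SE(3):he_3=e_3\}$ acts on $Q$ by $(h,y)\cdot(g,\mathbf{x})=(hg,h\mathbf{x}+y)$; the cotangent lift restricts to a free and proper action on $\mathcal{M}$ preserving $\{\cdot,\cdot\}^B_{\mathrm{nh}}$. The orbit projection is $\rho:\mathcal{M}\to\mathcal{R}\cong S^2\times\mathbb{R}^3$,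 $\rho(g,\mathbf{x},K)=(\gamma,K)$, $\gamma=g^{-1}e_3$. On $\|\gamma\|=1$, $\Omega$ is the function of $(\gamma,K)$ determined by $K=\mathbb{I}\Omega$ (rank 0), $K=\mathbb{I}\Omega+mr^2(\Omega\cdot\gamma)\gamma$ (rank 1), $K=(\mathbb{I}+mr^2E)\Omega-mr^2(\Omega\cdot\gamma)\gamma$ (rank 2), $K=(\mathbb{I}+mr^2E)\Omega$ (rank 3), $E$ the identity matrix. The entries of $\gamma$ are redundant coordinates on $S^2$; $\|\gamma\|^2$ is a Casimir function of each $\{\cdot,\cdot\}'_{\mathrm{Rank}j}$. *)

theory Defs
  imports "HOL-Analysis.Analysis"
begin

section \<open>Calculus on submanifolds of Euclidean spaces\<close>

text \<open>
  All manifolds below are closed embedded submanifolds \<open>S\<close> of Euclidean spaces. Tangent vectors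
  are velocities of curves in \<open>S\<close> that are differentiable at \<open>0\<close>. Forms on \<open>S\<close> are given by
  formulas on the ambient space, of which only the values on tangent vectors of \<open>S\<close> matter.
\<close>

definition tangent_space :: "'a::euclidean_space set \<Rightarrow> 'a \<Rightarrow> 'a set" where
  "tangent_space S z =
     {v. \<exists>c::real \<Rightarrow> 'a. c 0 = z \<and> (\<forall>t. c t \<in> S) \<and> (c has_vector_derivative v) (at 0)}"

text \<open>
  Exterior derivative of a vector-valued 1-form \<open>\<theta>\<close>, with the convention
  \<open>d(f dg)(u, v) = df(u) dg(v) - df(v) dg(u)\<close>. It commutes with the restriction to a submanifold.
\<close>

definition ext_deriv ::
  "('a::euclidean_space \<Rightarrow> 'a \<Rightarrow> 'b::real_normed_vector) \<Rightarrow> 'a \<Rightarrow> 'a \<Rightarrow> 'a \<Rightarrow> 'b" where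
  "ext_deriv \<theta> z u v =
     frechet_derivative (\<lambda>w. \<theta> w v) (at z) u - frechet_derivative (\<lambda>w. \<theta> w u) (at z) v"

text \<open>
  The differential at \<open>z\<close> of a function on \<open>S\<close>. The derivative within \<open>S\<close> is a linear form on the
  ambient space that is determined only on \<open>tangent_space S z\<close>.
\<close>

definition differential_on :: "'a::euclidean_space set \<Rightarrow> ('a \<Rightarrow> real) \<Rightarrow> 'a \<Rightarrow> 'a \<Rightarrow> real" where
  "differential_on S f z = frechet_derivative f (at z within S)"

primrec Ck :: "nat \<Rightarrow> ('a::euclidean_space \<Rightarrow> real) \<Rightarrow> bool" where
  "Ck 0 f \<longleftrightarrow> continuous_on UNIV f"
| "Ck (Suc k) f \<longleftrightarrow>
     (\<forall>x. f differentiable (at x)) \<and> (\<forall>v. Ck k (\<lambda>x. frechet_derivative f (at x) v))"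

definition smooth :: "('a::euclidean_space \<Rightarrow> real) \<Rightarrow> bool" where
  "smooth f \<longleftrightarrow> (\<forall>k. Ck k f)"

text \<open>
  Smooth functions on a closed embedded submanifold are the restrictions of smooth functions on the
  ambient space.
\<close>

definition smooth_extension :: "'a::euclidean_space set \<Rightarrow> ('a \<Rightarrow> real) \<Rightarrow> ('a \<Rightarrow> real) \<Rightarrow> bool" where
  "smooth_extension S f F \<longleftrightarrow> smooth F \<and> (\<forall>x\<in>S. F x = f x)"

definition smooth_on_submanifold :: "'a::euclidean_space set \<Rightarrow> ('a \<Rightarrow> real) \<Rightarrow> bool" where
  "smooth_on_submanifold S f \<longleftrightarrow> (\<exists>F. smooth_extension S f F)"


section \<open>Generalized rolling constraints\<close>

definition e3 :: "real^3" where
  "e3 = axis 3 1"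

definition block_mat :: "real^2^2 \<Rightarrow> real \<Rightarrow> real^3^3" where
  "block_mat C c = vector [vector [C$1$1, C$1$2, 0],
                           vector [C$2$1, C$2$2, 0],
                           vector [0,     0,     c]]"

definition generalized_rolling :: "real^3^3 \<Rightarrow> bool" where
  "generalized_rolling A \<longleftrightarrow>
     (\<exists>C. rotation_matrix C \<and> A = block_mat C 1) \<or>
     (\<exists>C. rotation_matrix C \<and> A = block_mat C 0) \<or>
     A = (\<chi> i k. e3$i * e3$k) \<or>
     A = 0"


section \<open>The configuration space and the constrained Lagrangian system\<close>

type_synonym config = "(real^3^3) \<times> (real^3)"
type_synonym phase = "config \<times> config"

definition Q :: "config set" where
  "Q = {(g, x). rotation_matrix g}"

text \<open>The inverse of the hat map, \<open>\<omega>\<^sup>^ y = cross3 \<omega> y\<close>.\<close>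

definition vee :: "real^3^3 \<Rightarrow> real^3" where
  "vee W = vector [W$3$2, W$1$3, W$2$1]"

text \<open>
  The left Maurer-Cartan form of \<open>SO(3)\<close>. Here and below \<open>transpose g\<close> stands for the inverse of
  the rotation matrix \<open>g\<close>.
\<close>

definition maurer_cartan :: "real^3^3 \<Rightarrow> real^3^3 \<Rightarrow> real^3" where
  "maurer_cartan g dg = vee (transpose g ** dg)"

definition inertia :: "real^3 \<Rightarrow> real^3^3" where
  "inertia I = (\<chi> i k. if i = k then I$i else 0)"

definition lagrangian :: "real \<Rightarrow> real^3 \<Rightarrow> config \<Rightarrow> config \<Rightarrow> real" where
  "lagrangian m I = (\<lambda>(g, x) (dg, dx).
     (1/2) * ((inertia I *v maurer_cartan g dg) \<bullet> maurer_cartan g dg) + (m/2) * (norm dx)\<^sup>2)"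

definition constraint_form :: "real \<Rightarrow> real^3^3 \<Rightarrow> config \<Rightarrow> config \<Rightarrow> real^3" where
  "constraint_form r A = (\<lambda>(g, x) (dg, dx). dx - r *\<^sub>R (A *v (g *v maurer_cartan g dg)))"

definition constraint_distribution :: "real \<Rightarrow> real^3^3 \<Rightarrow> phase set" where
  "constraint_distribution r A =
     {(q, v). q \<in> Q \<and> v \<in> tangent_space Q q \<and> constraint_form r A q v = 0}"


section \<open>The cotangent bundle and the constraint manifold\<close>

text \<open>
  The cotangent bundle of \<open>Q\<close> is realised as \<open>{(q, p). q \<in> Q \<and> p \<in> tangent_space Q q}\<close>: the vector
  \<open>p\<close> represents the covector \<open>w \<mapsto> p \<bullet> w\<close>, where \<open>\<bullet>\<close> is the standard inner product of the ambient
  space. The canonical 1-form is then \<open>(u, w) \<mapsto> p \<bullet> u\<close>, as \<open>u\<close> is the projection of \<open>(u, w)\<close> to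
  the tangent space of \<open>Q\<close>.
\<close>

definition legendre :: "real \<Rightarrow> real^3 \<Rightarrow> phase \<Rightarrow> phase" where
  "legendre m I = (\<lambda>(q, v). (q, THE p. p \<in> tangent_space Q q \<and>
     (\<forall>w\<in>tangent_space Q q.
        ((\<lambda>s. lagrangian m I q (v + s *\<^sub>R w)) has_real_derivative (p \<bullet> w)) (at 0))))"

definition constraint_manifold :: "real \<Rightarrow> real \<Rightarrow> real^3 \<Rightarrow> real^3^3 \<Rightarrow> phase set" where
  "constraint_manifold m r I A = legendre m I ` constraint_distribution r A"

definition canonical_1form :: "phase \<Rightarrow> phase \<Rightarrow> real" where
  "canonical_1form z w = snd z \<bullet> fst w"

definition canonical_2form :: "phase \<Rightarrow> phase \<Rightarrow> phase \<Rightarrow> real" where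
  "canonical_2form z u v = - ext_deriv canonical_1form z u v"

definition constraint_subspace ::
  "real \<Rightarrow> real \<Rightarrow> real^3 \<Rightarrow> real^3^3 \<Rightarrow> phase \<Rightarrow> phase set" where
  "constraint_subspace m r I A z =
     {v \<in> tangent_space (constraint_manifold m r I A) z. constraint_form r A (fst z) (fst v) = 0}"

text \<open>The body angular velocity and the variable \<open>K\<close> as functions on the constraint manifold.\<close>

definition Omega_of :: "real \<Rightarrow> real \<Rightarrow> real^3 \<Rightarrow> real^3^3 \<Rightarrow> phase \<Rightarrow> real^3" where
  "Omega_of m r I A z =
     (let ((g, x), (dg, dx)) = the_inv_into (constraint_distribution r A) (legendre m I) z
      in maurer_cartan g dg)"

definition K_of :: "real \<Rightarrow> real \<Rightarrow> real^3 \<Rightarrow> real^3^3 \<Rightarrow> phase \<Rightarrow> real^3" where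
  "K_of m r I A z =
     (let g = fst (fst z); \<Omega> = Omega_of m r I A z
      in inertia I *v \<Omega> + (m * r\<^sup>2) *\<^sub>R (transpose g *v (transpose A *v (A *v (g *v \<Omega>)))))"


section \<open>The nonholonomic bivector and its gauge transformation\<close>

definition nh_sharp ::
  "real \<Rightarrow> real \<Rightarrow> real^3 \<Rightarrow> real^3^3 \<Rightarrow> phase \<Rightarrow> (phase \<Rightarrow> real) \<Rightarrow> phase" where
  "nh_sharp m r I A z \<alpha> =
     - (THE X. X \<in> constraint_subspace m r I A z \<and>
               (\<forall>v\<in>constraint_subspace m r I A z. canonical_2form z X v = \<alpha> v))"

text \<open>
  The gauge transformation at a point with tangent space \<open>T\<close> by a 2-form \<open>B\<close>: its graph consists of
  the pairs \<open>(X, \<alpha> + i\<^sub>X B)\<close> with \<open>X = sharp \<alpha>\<close>. Covectors are linear forms restricted to \<open>T\<close>.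
\<close>

definition gauge_sharp ::
  "'a::euclidean_space set \<Rightarrow> ('a \<Rightarrow> 'a \<Rightarrow> real) \<Rightarrow> (('a \<Rightarrow> real) \<Rightarrow> 'a) \<Rightarrow> ('a \<Rightarrow> real) \<Rightarrow> 'a" where
  "gauge_sharp T B sharp \<beta> =
     (THE X. \<exists>\<alpha>. linear \<alpha> \<and> X = sharp \<alpha> \<and> (\<forall>v\<in>T. \<beta> v = \<alpha> v + B X v))"

definition gauge_form ::
  "real \<Rightarrow> real \<Rightarrow> real^3 \<Rightarrow> real^3^3 \<Rightarrow> phase \<Rightarrow> phase \<Rightarrow> phase \<Rightarrow> real" where
  "gauge_form m r I A z u v =
     - (m * r\<^sup>2) * (Omega_of m r I A z \<bullet>
        ext_deriv maurer_cartan (fst (fst z)) (fst (fst u)) (fst (fst v)))"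

definition nhB_sharp ::
  "real \<Rightarrow> real \<Rightarrow> real^3 \<Rightarrow> real^3^3 \<Rightarrow> phase \<Rightarrow> (phase \<Rightarrow> real) \<Rightarrow> phase" where
  "nhB_sharp m r I A z =
     gauge_sharp (tangent_space (constraint_manifold m r I A) z)
       (gauge_form m r I A z) (nh_sharp m r I A z)"

text \<open>The sign convention is \<open>{f1, f2} = \<pi>(df1, df2) = df2(\<pi>\<^sup>\<sharp>(df1))\<close>.\<close>

definition nhB_bracket ::
  "real \<Rightarrow> real \<Rightarrow> real^3 \<Rightarrow> real^3^3 \<Rightarrow> (phase \<Rightarrow> real) \<Rightarrow> (phase \<Rightarrow> real) \<Rightarrow> phase \<Rightarrow> real" where
  "nhB_bracket m r I A f1 f2 z =
     (let M = constraint_manifold m r I A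
      in differential_on M f2 z (nhB_sharp m r I A z (differential_on M f1 z)))"


section \<open>Reduction\<close>

type_synonym reduced = "(real^3) \<times> (real^3)"

definition H :: "((real^3^3) \<times> (real^3)) set" where
  "H = {(h, y). rotation_matrix h \<and> h *v e3 = e3}"

text \<open>
  The cotangent lift of the action \<open>(h, y)\<cdot>(g, x) = (hg, hx + y)\<close>. The tangent map
  \<open>(dg, dx) \<mapsto> (h dg, h dx)\<close> is an isometry, so covectors, represented by tangent vectors, transform
  in the same way.
\<close>

definition cotangent_lift :: "(real^3^3) \<times> (real^3) \<Rightarrow> phase \<Rightarrow> phase" where
  "cotangent_lift = (\<lambda>(h, y) ((g, x), (pg, px)). ((h ** g, h *v x + y), (h ** pg, h *v px)))"

definition R :: "reduced set" where
  "R = {(\<gamma>, K). norm \<gamma> = 1}"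

definition \<rho> :: "real \<Rightarrow> real \<Rightarrow> real^3 \<Rightarrow> real^3^3 \<Rightarrow> phase \<Rightarrow> reduced" where
  "\<rho> m r I A z = (transpose (fst (fst z)) *v e3, K_of m r I A z)"

text \<open>
  \<open>\<rho>\<close> identifies the orbit space \<open>M/H\<close> with \<open>R\<close>: it maps \<open>M\<close> onto \<open>R\<close>, and its fibres in \<open>M\<close> are
  exactly the \<open>H\<close>-orbits.
\<close>

definition is_orbit_projection :: "real \<Rightarrow> real \<Rightarrow> real^3 \<Rightarrow> real^3^3 \<Rightarrow> bool" where
  "is_orbit_projection m r I A \<longleftrightarrow>
     (let M = constraint_manifold m r I A in
        \<rho> m r I A ` M = R \<and>
        (\<forall>z\<in>M. {w \<in> M. \<rho> m r I A w = \<rho> m r I A z} = (\<lambda>h. cotangent_lift h z) ` H))"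

definition is_reduced_bracket ::
  "real \<Rightarrow> real \<Rightarrow> real^3 \<Rightarrow> real^3^3 \<Rightarrow>
   ((reduced \<Rightarrow> real) \<Rightarrow> (reduced \<Rightarrow> real) \<Rightarrow> reduced \<Rightarrow> real) \<Rightarrow> bool" where
  "is_reduced_bracket m r I A br \<longleftrightarrow>
     (\<forall>f1 f2. smooth_on_submanifold R f1 \<longrightarrow> smooth_on_submanifold R f2 \<longrightarrow>
        (\<forall>z\<in>constraint_manifold m r I A.
           br f1 f2 (\<rho> m r I A z) =
           nhB_bracket m r I A (f1 \<circ> \<rho> m r I A) (f2 \<circ> \<rho> m r I A) z))"


section \<open>The brackets in the redundant coordinates\<close>

definition K_relation :: "real \<Rightarrow> real \<Rightarrow> real^3 \<Rightarrow> nat \<Rightarrow> real^3 \<Rightarrow> real^3 \<Rightarrow> real^3" where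
  "K_relation m r I j \<gamma> \<Omega> =
     (if j = 0 then inertia I *v \<Omega>
      else if j = 1 then inertia I *v \<Omega> + (m * r\<^sup>2 * (\<Omega> \<bullet> \<gamma>)) *\<^sub>R \<gamma>
      else if j = 2 then (inertia I + (m * r\<^sup>2) *\<^sub>R mat 1) *v \<Omega> - (m * r\<^sup>2 * (\<Omega> \<bullet> \<gamma>)) *\<^sub>R \<gamma>
      else (inertia I + (m * r\<^sup>2) *\<^sub>R mat 1) *v \<Omega>)"

text \<open>The solution is unique for \<open>norm \<gamma> = 1\<close>; elsewhere it may fail to exist (rank 2).\<close>

definition Omega_red :: "real \<Rightarrow> real \<Rightarrow> real^3 \<Rightarrow> nat \<Rightarrow> real^3 \<Rightarrow> real^3 \<Rightarrow> real^3" where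
  "Omega_red m r I j \<gamma> K = (THE \<Omega>. K = K_relation m r I j \<gamma> \<Omega>)"

definition N' :: "real \<Rightarrow> real \<Rightarrow> real^3 \<Rightarrow> nat \<Rightarrow> real^3 \<Rightarrow> real^3 \<Rightarrow> real^3" where
  "N' m r I j \<gamma> K =
     (let \<Omega> = Omega_red m r I j \<gamma> K in
      if j = 0 then K - (m * r\<^sup>2) *\<^sub>R \<Omega>
      else if j = 1 then K - (m * r\<^sup>2) *\<^sub>R \<Omega> + (m * r\<^sup>2 * (\<Omega> \<bullet> \<gamma>)) *\<^sub>R \<gamma>
      else if j = 2 then K - (m * r\<^sup>2 * (\<Omega> \<bullet> \<gamma>)) *\<^sub>R \<gamma>
      else K)"

definition grad_\<gamma> :: "(reduced \<Rightarrow> real) \<Rightarrow> reduced \<Rightarrow> real^3" where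
  "grad_\<gamma> F = (\<lambda>(\<gamma>, K). \<chi> i. frechet_derivative (\<lambda>\<xi>. F (\<xi>, K)) (at \<gamma>) (axis i 1))"

definition grad_K :: "(reduced \<Rightarrow> real) \<Rightarrow> reduced \<Rightarrow> real^3" where
  "grad_K F = (\<lambda>(\<gamma>, K). \<chi> i. frechet_derivative (\<lambda>\<kappa>. F (\<gamma>, \<kappa>)) (at K) (axis i 1))"

definition rank_bracket ::
  "real \<Rightarrow> real \<Rightarrow> real^3 \<Rightarrow> nat \<Rightarrow> (reduced \<Rightarrow> real) \<Rightarrow> (reduced \<Rightarrow> real) \<Rightarrow> reduced \<Rightarrow> real" where
  "rank_bracket m r I j F1 F2 = (\<lambda>(\<gamma>, K).
     - (N' m r I j \<gamma> K \<bullet> cross3 (grad_K F1 (\<gamma>, K)) (grad_K F2 (\<gamma>, K)))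
     - \<gamma> \<bullet> (cross3 (grad_K F1 (\<gamma>, K)) (grad_\<gamma> F2 (\<gamma>, K))
            - cross3 (grad_K F2 (\<gamma>, K)) (grad_\<gamma> F1 (\<gamma>, K))))"

text \<open>
  A bracket on \<open>R\<close> is the restriction of a bracket on the ambient space if it can be computed from
  arbitrary smooth extensions of its arguments.
\<close>

definition is_restriction_to_R ::
  "((reduced \<Rightarrow> real) \<Rightarrow> (reduced \<Rightarrow> real) \<Rightarrow> reduced \<Rightarrow> real) \<Rightarrow>
   ((reduced \<Rightarrow> real) \<Rightarrow> (reduced \<Rightarrow> real) \<Rightarrow> reduced \<Rightarrow> real) \<Rightarrow> bool" where
  "is_restriction_to_R br br' \<longleftrightarrow>
     (\<forall>f1 f2 F1 F2. smooth_extension R f1 F1 \<longrightarrow> smooth_extension R f2 F2 \<longrightarrow>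
        (\<forall>y\<in>R. br f1 f2 y = br' F1 F2 y))"

end

theory Submission
  imports Defs
begin

text \<open>
  In every rank \<open>A\<^sup>T A = diag(\<kappa>, \<kappa>, s\<^sup>2)\<close>, so all cases are treated at once through the two
  parameters \<open>\<kappa>\<close> and \<open>\<epsilon> = s\<^sup>2 - \<kappa>\<close>: the rolling term \<open>S = g\<^sup>T A\<^sup>T A g\<close> of \<open>K = \<I> \<Omega> + m r\<^sup>2 S \<Omega>\<close>
  is \<open>S w = \<kappa> w + \<epsilon> (w \<bullet> \<gamma>) \<gamma>\<close>.
  A vector in the constraint subspace is determined by its left-trivialised
  angular velocity \<open>a\<close> and by the velocity \<open>h\<close> of \<open>K\<close>. In these coordinates the canonical
  2-form is \<open>a \<bullet> k - b \<bullet> h + (a \<times> b) \<bullet> (K + m r\<^sup>2 S \<Omega>)\<close> at the pair \<open>(a, h), (b, k)\<close>,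
  while \<open>B\<close> is \<open>m r\<^sup>2 \<Omega> \<bullet> (a \<times> b)\<close>. Hence the gauged form
  has the same shape with \<open>N = K + m r\<^sup>2 (S \<Omega> - \<Omega>)\<close>, which equals \<open>N'\<close> in each rank,
  and inverting it on the differential of \<open>f(\<gamma>, K)\<close> gives
  \<open>a = - \<partial>f/\<partial>K\<close> and \<open>h = \<partial>f/\<partial>\<gamma> \<times> \<gamma> - N \<times> \<partial>f/\<partial>K\<close>.
\<close>

subsection \<open>The hat map and rotation matrices\<close>

definition hat :: "real^3 \<Rightarrow> real^3^3" where
  "hat w = vector [vector [0, - w$3, w$2], vector [w$3, 0, - w$1], vector [- w$2, w$1, 0]]"

text \<open>As a simp rule it rewrites \<open>transpose X *v y\<close> to \<open>y v* X\<close>,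
  which would hide the inverse rotations from the cancellation rules below.\<close>

declare transpose_matrix_vector [simp del]

lemmas mat3_simps = vec_eq_iff forall_3 sum_3 matrix_matrix_mult_def matrix_vector_mult_def
  transpose_def mat_def inner_vec_def

lemma linear_hat: "linear hat"
  by (rule linearI) (simp_all add: hat_def mat3_simps)

lemma linear_vee: "linear vee"
  by (rule linearI) (simp_all add: vee_def mat3_simps)

lemmas hat_linear_simps = linear_add[OF linear_hat] linear_cmul[OF linear_hat]
  linear_0[OF linear_hat] linear_neg[OF linear_hat] linear_diff[OF linear_hat]

lemmas vee_linear_simps = linear_add[OF linear_vee] linear_cmul[OF linear_vee]
  linear_0[OF linear_vee] linear_neg[OF linear_vee] linear_diff[OF linear_vee]

lemma vee_hat [simp]: "vee (hat w) = w"
  by (simp add: hat_def vee_def mat3_simps)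

lemma hat_vee:
  assumes "transpose W = - W" shows "hat (vee W) = W"
proof -
  have *: "W$i$k = - W$k$i" for i k
    using arg_cong[OF assms, of "\<lambda>X. X$k$i"] by (simp add: transpose_def)
  have "W$1$1 = 0" "W$2$2 = 0" "W$3$3 = 0"
    using *[of 1 1] *[of 2 2] *[of 3 3] by simp_all
  then show ?thesis
    using *[of 1 2] *[of 3 1] *[of 2 3] by (simp add: hat_def vee_def vec_eq_iff forall_3)
qed

lemma transpose_hat: "transpose (hat w) = - hat w"
  by (simp add: hat_def mat3_simps)

lemma hat_mult_vector: "hat a *v b = cross3 a b"
  by (simp add: hat_def cross3_def mat3_simps algebra_simps)

lemma vee_hat_mult_hat: "vee (hat a ** hat b) - vee (hat b ** hat a) = cross3 a b"
  by (simp add: hat_def vee_def cross3_def mat3_simps algebra_simps)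

lemma inner_hat_hat: "hat a \<bullet> hat b = 2 * (a \<bullet> b)"
  by (simp add: hat_def mat3_simps)

text \<open>The antisymmetrised product is a trace against the commutator of two hat matrices, which
  is \<open>hat (cross3 a b)\<close>. The momentum term of the canonical 2-form comes from
  here.\<close>

lemma inner_hat_commutator:
  "hat a \<bullet> (hat b ** hat P) - hat b \<bullet> (hat a ** hat P) = 2 * (P \<bullet> cross3 a b)"
  by (simp add: hat_def cross3_def mat3_simps algebra_simps)

lemma inner_matrix_mult_left: "(X ** Y) \<bullet> Z = Y \<bullet> (transpose X ** Z)" for X Y Z :: "real^3^3"
  by (simp add: mat3_simps algebra_simps)

lemma inner_matrix_vector: "(X *v y) \<bullet> z = y \<bullet> (transpose X *v z)" for X :: "real^3^3"
  by (simp add: mat3_simps algebra_simps)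

lemma cross3_triple: "cross3 a b \<bullet> c = b \<bullet> cross3 c a"
  by (simp add: cross3_def mat3_simps algebra_simps)

lemma rotation_transpose_mult:
  assumes "rotation_matrix g"
  shows "transpose g ** g = mat 1" "g ** transpose g = mat 1"
  using assms by (auto simp: rotation_matrix_def orthogonal_matrix_def)

lemma rotation_cancel:
  fixes g :: "real^3^3" assumes "rotation_matrix g"
  shows "transpose g ** (g ** X) = X" "g ** (transpose g ** X) = X"
    "transpose g *v (g *v y) = y" "g *v (transpose g *v y) = y"
  by (simp_all add: matrix_mul_assoc matrix_vector_mul_assoc rotation_transpose_mult[OF assms])

lemma rotation_transpose: "rotation_matrix g \<Longrightarrow> rotation_matrix (transpose g)"
  by (simp add: rotation_matrix_def orthogonal_matrix_transpose det_transpose)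

lemma rotation_mult:
  fixes g h :: "real^3^3"
  shows "rotation_matrix g \<Longrightarrow> rotation_matrix h \<Longrightarrow> rotation_matrix (g ** h)"
  by (auto simp: rotation_matrix_def orthogonal_matrix_mul det_mul)

lemma inner_rotation_matrix_mult:
  fixes g X Y :: "real^3^3" assumes "rotation_matrix g" shows "(g ** X) \<bullet> (g ** Y) = X \<bullet> Y"
  by (simp add: inner_matrix_mult_left rotation_cancel[OF assms])

lemma inner_rotation_vector:
  fixes g :: "real^3^3" assumes "rotation_matrix g" shows "(g *v a) \<bullet> (g *v b) = a \<bullet> b"
  by (simp add: inner_matrix_vector rotation_cancel[OF assms])

lemma rotation_mult_cancel:
  fixes g :: "real^3^3"
  assumes "rotation_matrix g" shows "g ** X = g ** Y \<longleftrightarrow> X = Y"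
  by (metis rotation_cancel(1)[OF assms])

section \<open>Matrix products, transposition and the hat map under differentiation\<close>

lemma bounded_bilinear_matrix_mult:
  "bounded_bilinear ((**) :: real^3^3 \<Rightarrow> real^3^3 \<Rightarrow> real^3^3)"
  unfolding bilinear_conv_bounded_bilinear[symmetric] bilinear_def
  by (auto intro!: linearI simp: mat3_simps algebra_simps)

lemma bounded_bilinear_matrix_vector:
  "bounded_bilinear ((*v) :: real^3^3 \<Rightarrow> real^3 \<Rightarrow> real^3)"
  unfolding bilinear_conv_bounded_bilinear[symmetric] bilinear_def
  by (auto intro!: linearI simp: mat3_simps algebra_simps)

lemmas matrix_mult_simps =
  bounded_bilinear.add_left[OF bounded_bilinear_matrix_mult]
  bounded_bilinear.add_right[OF bounded_bilinear_matrix_mult]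
  bounded_bilinear.diff_left[OF bounded_bilinear_matrix_mult]
  bounded_bilinear.diff_right[OF bounded_bilinear_matrix_mult]
  bounded_bilinear.minus_left[OF bounded_bilinear_matrix_mult]
  bounded_bilinear.minus_right[OF bounded_bilinear_matrix_mult]
  bounded_bilinear.zero_left[OF bounded_bilinear_matrix_mult]
  bounded_bilinear.zero_right[OF bounded_bilinear_matrix_mult]
  bounded_bilinear.scaleR_left[OF bounded_bilinear_matrix_mult]
  bounded_bilinear.scaleR_right[OF bounded_bilinear_matrix_mult]

lemma bounded_linear_transpose: "bounded_linear (transpose :: real^3^3 \<Rightarrow> real^3^3)"
  unfolding linear_conv_bounded_linear[symmetric]
  by (auto intro!: linearI simp: mat3_simps)

lemma bounded_linear_hat: "bounded_linear hat"
  using linear_hat linear_conv_bounded_linear by blast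

lemma bounded_linear_vee: "bounded_linear vee"
  using linear_vee linear_conv_bounded_linear by blast

lemmas matrix_mult_deriv = bounded_bilinear.has_vector_derivative[OF bounded_bilinear_matrix_mult]
lemmas matrix_vector_deriv = bounded_bilinear.has_vector_derivative[OF bounded_bilinear_matrix_vector]

section \<open>Tangent vectors of the rotation group\<close>

text \<open>Differentiating \<open>transpose (G t) ** G t = mat 1\<close> makes
  \<open>transpose (G 0) ** g'\<close> skew, hence a hat matrix.\<close>

lemma tangent_rotation:
  assumes rot: "\<And>t. rotation_matrix (G t)"
    and G: "(G has_vector_derivative g') (at 0)"
  shows "g' = G 0 ** hat (vee (transpose (G 0) ** g'))"
proof -
  have "((\<lambda>t. transpose (G t) ** G t) has_vector_derivative
      transpose (G 0) ** g' + transpose g' ** G 0) (at 0)"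
    using matrix_mult_deriv[OF bounded_linear.has_vector_derivative[OF bounded_linear_transpose G] G]
    by simp
  moreover have "((\<lambda>t. transpose (G t) ** G t) has_vector_derivative 0) (at 0)"
    by (simp add: rotation_transpose_mult[OF rot])
  ultimately have "transpose (G 0) ** g' + transpose g' ** G 0 = 0"
    by (rule vector_derivative_unique_at)
  hence "transpose (transpose (G 0) ** g') = - (transpose (G 0) ** g')"
    by (simp add: matrix_transpose_mul eq_neg_iff_add_eq_0 add.commute)
  from hat_vee[OF this] show ?thesis
    by (simp add: rotation_cancel[OF rot])
qed

text \<open>The Cayley transform of \<open>hat b\<close>, written as a polynomial in \<open>hat b\<close>.\<close>

definition cayley :: "real^3 \<Rightarrow> real^3^3" where
  "cayley b = mat 1 + (2 / (1 + b \<bullet> b)) *\<^sub>R (hat b + hat b ** hat b)"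

text \<open>Cayley-Hamilton for a skew matrix: all powers of \<open>hat b\<close> stay in the span
  of \<open>mat 1\<close>, \<open>hat b\<close> and \<open>hat b ** hat b\<close>.\<close>

lemma hat_cubed: "hat b ** (hat b ** hat b) = - (b \<bullet> b) *\<^sub>R hat b"
  by (simp add: hat_def mat3_simps algebra_simps)

text \<open>After reduction with \<open>hat_cubed\<close>, the relation
  \<open>k + k * (b \<bullet> b) = 2\<close> for the coefficient \<open>k\<close> is exactly what
  removes the \<open>B ** B\<close> term from
  \<open>transpose (cayley b) ** cayley b\<close>.\<close>

lemma rotation_cayley: "rotation_matrix (cayley b)"
proof -
  define k B where "k = 2 / (1 + b \<bullet> b)" and "B = hat b"
  have pos: "1 + b \<bullet> b > 0" by (simp add: add_pos_nonneg)
  hence "k * (1 + b \<bullet> b) = 2"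
    unfolding k_def by (metis less_numeral_extra(3) nonzero_eq_divide_eq)
  hence k: "k + k * (b \<bullet> b) = 2"
    by (simp add: distrib_left)
  have c: "cayley b = mat 1 + k *\<^sub>R B + k *\<^sub>R (B ** B)"
    by (simp add: cayley_def k_def B_def scaleR_right_distrib)
  have tB: "transpose B = - B"
    by (simp add: B_def transpose_hat)
  have tS: "transpose (B ** B) = B ** B"
    by (simp add: matrix_transpose_mul tB matrix_mult_simps)
  have ct: "transpose (cayley b) = mat 1 - k *\<^sub>R B + k *\<^sub>R (B ** B)"
    unfolding c bounded_linear_transpose[THEN bounded_linear.linear, THEN linear_add]
      bounded_linear_transpose[THEN bounded_linear.linear, THEN linear_cmul] tS
    by (simp add: tB transpose_mat)
  have B3: "B ** (B ** B) = - (b \<bullet> b) *\<^sub>R B"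
    by (simp add: B_def hat_cubed)
  have "transpose (cayley b) ** cayley b
      = mat 1 + (k + k - k * (k + k * (b \<bullet> b))) *\<^sub>R (B ** B)"
    unfolding ct unfolding c
    by (simp add: matrix_mult_simps B3 matrix_mul_assoc[symmetric])
      (simp add: vec_eq_iff algebra_simps)
  hence "transpose (cayley b) ** cayley b = mat 1"
    by (simp add: k)
  moreover have "det (cayley b) = 1"
  proof -
    \<comment> \<open>This is the usual description of the Cayley transform as the quotient of
      \<open>mat 1 + B\<close> by \<open>mat 1 - B\<close>. These two are transposes of each other,
      so their determinants agree.\<close>
    have "(mat 1 - B) ** cayley b = mat 1 + (k + k * (b \<bullet> b) - 1) *\<^sub>R B"
      unfolding c
      by (simp add: matrix_mult_simps B3 matrix_mul_assoc[symmetric] algebra_simps)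
    hence "det (mat 1 - B) * det (cayley b) = det (mat 1 + B)"
      by (simp add: k det_mul[symmetric])
    moreover have "det (mat 1 - B) = 1 + b \<bullet> b" "det (mat 1 + B) = 1 + b \<bullet> b"
      by (simp_all add: det_3 B_def hat_def mat3_simps algebra_simps)
    ultimately show ?thesis using pos by simp
  qed
  ultimately show ?thesis
    by (simp add: rotation_matrix_def orthogonal_matrix)
qed

text \<open>The argument is halved because \<open>cayley b\<close> is
  \<open>mat 1 + 2 *\<^sub>R hat b\<close> to first order.\<close>

lemma cayley_curve_deriv: "((\<lambda>t. cayley ((t / 2) *\<^sub>R b)) has_vector_derivative hat b) (at 0)"
proof -
  have eq: "cayley ((t / 2) *\<^sub>R b) = mat 1 + (t / (1 + (t/2)^2 * (b \<bullet> b))) *\<^sub>R hat b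
      + (t^2 / 2 / (1 + (t/2)^2 * (b \<bullet> b))) *\<^sub>R (hat b ** hat b)" for t
    by (simp add: cayley_def hat_linear_simps matrix_mult_simps scaleR_right_distrib
        power2_eq_square field_simps)
  have d1: "((\<lambda>t. t / (1 + (t/2)^2 * (b \<bullet> b))) has_real_derivative 1) (at 0)"
    by (auto intro!: derivative_eq_intros)
  have d2: "((\<lambda>t. t^2 / 2 / (1 + (t/2)^2 * (b \<bullet> b))) has_real_derivative 0) (at 0)"
    by (auto intro!: derivative_eq_intros)
  show ?thesis
    unfolding eq
    using has_vector_derivative_add[OF has_vector_derivative_add[OF has_vector_derivative_const
        has_vector_derivative_scaleR[OF d1 has_vector_derivative_const]]
        has_vector_derivative_scaleR[OF d2 has_vector_derivative_const]]
    by simp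
qed

text \<open>\<open>tangent_space\<close> asks for curves that stay in the set at all real times;
  translated Cayley curves are rotations for every \<open>t\<close>.\<close>

lemma rotation_curve:
  fixes b :: "real^3"
  assumes "rotation_matrix g"
  obtains G where "\<And>t::real. rotation_matrix (G t)" "G 0 = g"
    "(G has_vector_derivative g ** hat b) (at 0)"
proof
  let ?G = "\<lambda>t::real. g ** cayley ((t / 2) *\<^sub>R b)"
  show "rotation_matrix (?G t)" for t
    by (intro rotation_mult assms rotation_cayley)
  show "?G 0 = g" by (simp add: cayley_def hat_linear_simps)
  show "(?G has_vector_derivative g ** hat b) (at 0)"
    using matrix_mult_deriv[OF has_vector_derivative_const cayley_curve_deriv, of g b] by simp
qed

lemma maurer_cartan_hat: "rotation_matrix g \<Longrightarrow> maurer_cartan g (g ** hat b) = b"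
  by (simp add: maurer_cartan_def rotation_cancel)

lemma tangent_space_Q:
  assumes "rotation_matrix g"
  shows "tangent_space Q (g, x) = {(g ** hat b, y) |b y. True}"
proof (intro equalityI subsetI)
  fix v assume "v \<in> tangent_space Q (g, x)"
  then obtain c where c: "c 0 = (g, x)" "\<And>t::real. c t \<in> Q" "(c has_vector_derivative v) (at 0)"
    by (auto simp: tangent_space_def)
  have "((\<lambda>t. fst (c t)) has_vector_derivative fst v) (at 0)"
    by (rule bounded_linear.has_vector_derivative[OF bounded_linear_fst c(3)])
  moreover have "rotation_matrix (fst (c t))" for t
    using c(2)[of t] by (auto simp: Q_def)
  ultimately have "fst v = g ** hat (vee (transpose g ** fst v))"
    using tangent_rotation[of "\<lambda>t. fst (c t)"] c(1) by simp
  then show "v \<in> {(g ** hat b, y) |b y. True}"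
    by (metis (mono_tags, lifting) mem_Collect_eq prod.collapse)
next
  fix v :: config assume "v \<in> {(g ** hat b, y) |b y. True}"
  then obtain b :: "real^3" and y :: "real^3" where v: "v = (g ** hat b, y)" by auto
  obtain G where G: "\<And>t::real. rotation_matrix (G t)" "G 0 = g"
    "(G has_vector_derivative g ** hat b) (at 0)"
    using rotation_curve[OF assms, where b = b] by blast
  have "((\<lambda>t. (G t, x + t *\<^sub>R y)) has_vector_derivative v) (at 0)"
    unfolding v by (intro has_vector_derivative_Pair G) (auto intro!: derivative_eq_intros)
  then show "v \<in> tangent_space Q (g, x)"
    using G(1,2) by (auto simp: tangent_space_def Q_def intro: exI[of _ "\<lambda>t. (G t, x + t *\<^sub>R y)"])
qed

subsection \<open>The Legendre transform\<close>

lemma inertia_nth [simp]: "(inertia I *v w)$i = I$i * w$i"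
  by (simp add: inertia_def matrix_vector_mult_def if_distrib[of "\<lambda>x. x * _"] cong: if_cong)

text \<open>Covectors are represented through the ambient inner product, for which
  \<open>hat a \<bullet> hat b\<close> is twice \<open>a \<bullet> b\<close>. The factor
  \<open>1/2\<close> in front of the body angular momentum compensates for this.\<close>

lemma legendre_eq:
  assumes g: "rotation_matrix g"
  shows "legendre m I ((g, x), (g ** hat \<Omega>, y))
    = ((g, x), (g ** hat ((1/2) *\<^sub>R (inertia I *v \<Omega>)), m *\<^sub>R y))"
proof -
  let ?p = "(g ** hat ((1/2) *\<^sub>R (inertia I *v \<Omega>)), m *\<^sub>R y)"
  let ?T = "tangent_space Q (g, x)"
  let ?D = "\<lambda>p w. ((\<lambda>t. lagrangian m I (g, x) ((g ** hat \<Omega>, y) + t *\<^sub>R w)) has_real_derivative (p \<bullet> w)) (at 0)"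
  have deriv: "?D ?p w" if w: "w \<in> ?T" for w
  proof -
    obtain b w' where w: "w = (g ** hat b, w')"
      using w by (auto simp: tangent_space_Q[OF g])
    have "lagrangian m I (g, x) ((g ** hat \<Omega>, y) + t *\<^sub>R w)
      = lagrangian m I (g, x) (g ** hat (\<Omega> + t *\<^sub>R b), y + t *\<^sub>R w')" for t
      by (simp add: w hat_linear_simps matrix_mult_simps)
    also have "\<dots>t = (1/2) * ((inertia I *v \<Omega>) \<bullet> \<Omega>) + (m/2) * (y \<bullet> y)
      + t * ((inertia I *v \<Omega>) \<bullet> b + m * (y \<bullet> w'))
      + t^2 * ((1/2) * ((inertia I *v b) \<bullet> b) + (m/2) * (w' \<bullet> w'))" for t
      unfolding lagrangian_def
      by (simp add: maurer_cartan_hat[OF g] power2_norm_eq_inner)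
        (simp add: inner_vec_def sum_3 power2_eq_square field_simps)
    finally have "(\<lambda>t. lagrangian m I (g, x) ((g ** hat \<Omega>, y) + t *\<^sub>R w)) = (\<lambda>t. 
        (1/2) * ((inertia I *v \<Omega>) \<bullet> \<Omega>) + (m/2) * (y \<bullet> y)
      + t * ((inertia I *v \<Omega>) \<bullet> b + m * (y \<bullet> w'))
      + t^2 * ((1/2) * ((inertia I *v b) \<bullet> b) + (m/2) * (w' \<bullet> w')))"
      by blast
    moreover have "?p \<bullet> w = (inertia I *v \<Omega>) \<bullet> b + m * (y \<bullet> w')"
      by (simp add: w inner_rotation_matrix_mult[OF g] inner_hat_hat)
    ultimately show ?thesis
      by (auto intro!: derivative_eq_intros)
  qed
  have "(THE p. p \<in> ?T \<and> (\<forall>w\<in>?T. ?D p w)) = ?p"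
  proof (rule the_equality)
    show "?p \<in> ?T \<and> (\<forall>w\<in>?T. ?D ?p w)"
      using deriv by (auto simp: tangent_space_Q[OF g])
  next
    fix p assume p: "p \<in> ?T \<and> (\<forall>w\<in>?T. ?D p w)"
    have "p \<bullet> w = ?p \<bullet> w" if "w \<in> ?T" for w
      using p deriv[OF that] that DERIV_unique by blast
    \<comment> \<open>The tangent space is linear, so the difference of two representatives may be
      tested against itself.\<close>
    moreover have "p - ?p \<in> ?T"
    proof -
      obtain b w' where "p = (g ** hat b, w')"
        using p by (auto simp: tangent_space_Q[OF g])
      then have "p - ?p = (g ** hat (b - (1/2) *\<^sub>R (inertia I *v \<Omega>)), w' - m *\<^sub>R y)"
        by (simp add: hat_linear_simps matrix_mult_simps)
      then show ?thesis by (auto simp: tangent_space_Q[OF g])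
    qed
    ultimately have "p \<bullet> (p - ?p) = ?p \<bullet> (p - ?p)" by blast
    then have "(p - ?p) \<bullet> (p - ?p) = 0"
      by (simp only: inner_diff_left diff_self)
    then show "p = ?p" by simp
  qed
  then show ?thesis by (simp add: legendre_def)
qed

section \<open>Exterior derivatives of the canonical and the Maurer-Cartan form\<close>

lemma canonical_2form_eq: "canonical_2form z u v = fst u \<bullet> snd v - snd u \<bullet> fst v"
proof -
  have "frechet_derivative (\<lambda>w. canonical_1form w v) (at z) u = snd u \<bullet> fst v" for u v
  proof -
    have "((\<lambda>w. canonical_1form w v) has_derivative (\<lambda>u. snd u \<bullet> fst v)) (at z)"
      unfolding canonical_1form_def by (auto intro!: derivative_eq_intros)
    then show ?thesis by (metis frechet_derivative_at)
  qed
  then show ?thesis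
    by (simp add: canonical_2form_def ext_deriv_def inner_commute)
qed

text \<open>The ambient formula \<open>vee (transpose g ** dg)\<close> is linear in
  \<open>g\<close>, so differentiating it replaces \<open>g\<close> by the direction.\<close>

lemma ext_deriv_maurer_cartan:
  "ext_deriv maurer_cartan g u v = vee (transpose u ** v) - vee (transpose v ** u)"
proof -
  have "frechet_derivative (\<lambda>w. maurer_cartan w v) (at g) u = vee (transpose u ** v)" for u v
  proof -
    have "bounded_linear (\<lambda>w. vee (transpose w ** v))"
      by (intro bounded_linear_compose[OF bounded_linear_vee]
        bounded_linear_compose[OF bounded_bilinear.bounded_linear_left[OF bounded_bilinear_matrix_mult]]
        bounded_linear_transpose)
    then have "((\<lambda>w. maurer_cartan w v) has_derivative (\<lambda>w. vee (transpose w ** v))) (at g)"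
      unfolding maurer_cartan_def by (rule bounded_linear_imp_has_derivative)
    then show ?thesis by (metis frechet_derivative_at)
  qed
  then show ?thesis by (simp add: ext_deriv_def)
qed

text \<open>The structure equation of the Maurer-Cartan form, evaluated on two left-trivialised
  vectors: the commutator of hat matrices becomes a cross product.\<close>

lemma ext_deriv_maurer_cartan_hat:
  assumes "rotation_matrix g"
  shows "ext_deriv maurer_cartan g (g ** hat a) (g ** hat b) = - cross3 a b"
  unfolding ext_deriv_maurer_cartan
  by (simp flip: vee_hat_mult_hat
      add: matrix_transpose_mul transpose_hat matrix_mult_simps vee_linear_simps
      matrix_mul_assoc[symmetric] rotation_cancel[OF assms])

subsection \<open>The constraint manifold\<close>

text \<open>The common shape of all constraint matrices: a scaled rotation of the plane orthogonal
  to \<open>e3\<close> and a scalar on the axis. The values belonging to each rank are imposed later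
  by \<open>rank_parameters\<close>.\<close>

locale rolling =
  fixes m r :: real and I :: "real^3" and A :: "real^3^3" and p q s :: real
  assumes m_pos: "m > 0" and r_pos: "r > 0" and I_pos: "\<And>i. I$i > 0"
    and A_eq: "A = vector [vector [p, - q, 0], vector [q, p, 0], vector [0, 0, s]]"
begin

definition \<kappa> :: real where "\<kappa> = p\<^sup>2 + q\<^sup>2"
definition \<epsilon> :: real where "\<epsilon> = s\<^sup>2 - \<kappa>"

abbreviation M :: "phase set" where "M \<equiv> constraint_manifold m r I A"

text \<open>\<open>rolling_part \<gamma>\<close> is \<open>g\<^sup>T A\<^sup>T A g\<close> for \<open>\<gamma> = g\<^sup>T e3\<close>.\<close>

definition rolling_part :: "real^3 \<Rightarrow> real^3 \<Rightarrow> real^3" where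
  "rolling_part \<gamma> w = \<kappa> *\<^sub>R w + (\<epsilon> * (w \<bullet> \<gamma>)) *\<^sub>R \<gamma>"

definition Kmap :: "real^3 \<Rightarrow> real^3 \<Rightarrow> real^3" where
  "Kmap \<gamma> w = inertia I *v w + (m * r\<^sup>2) *\<^sub>R rolling_part \<gamma> w"

definition Kmap_deriv :: "real^3 \<Rightarrow> real^3 \<Rightarrow> real^3 \<Rightarrow> real^3 \<Rightarrow> real^3" where
  "Kmap_deriv \<gamma> \<Omega> \<gamma>' \<Omega>' =
     Kmap \<gamma> \<Omega>' + (m * r\<^sup>2 * \<epsilon>) *\<^sub>R ((\<Omega> \<bullet> \<gamma>') *\<^sub>R \<gamma> + (\<Omega> \<bullet> \<gamma>) *\<^sub>R \<gamma>')"

text \<open>Half the body angular momentum, because of the factor in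
  \<open>inner_hat_hat\<close>.\<close>

definition momentum :: "real^3 \<Rightarrow> real^3" where
  "momentum \<Omega> = (1/2) *\<^sub>R (inertia I *v \<Omega>)"

text \<open>The Legendre image of the admissible velocity with body angular velocity
  \<open>\<Omega>\<close>; these points parametrise \<open>M\<close>.\<close>

definition point :: "real^3^3 \<Rightarrow> real^3 \<Rightarrow> real^3 \<Rightarrow> phase" where
  "point g x \<Omega> = ((g, x), (g ** hat (momentum \<Omega>), (m * r) *\<^sub>R (A *v (g *v \<Omega>))))"

text \<open>The velocity of a curve of \<open>point\<close>s along which \<open>g\<close>,
  \<open>x\<close> and \<open>\<Omega>\<close> move with velocities \<open>g ** hat b\<close>,
  \<open>y\<close> and \<open>w\<close>. The vector \<open>b\<close> is unrelated to
  \<open>\<Omega>\<close>.\<close>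

definition velocity :: "real^3^3 \<Rightarrow> real^3 \<Rightarrow> real^3 \<Rightarrow> real^3 \<Rightarrow> real^3 \<Rightarrow> phase" where
  "velocity g \<Omega> b y w = ((g ** hat b, y),
     (g ** (hat b ** hat (momentum \<Omega>)) + g ** hat (momentum w),
      (m * r) *\<^sub>R (A *v (g *v (cross3 b \<Omega> + w)))))"

lemma linear_momentum: "linear momentum"
  by (rule linearI) (simp_all add: momentum_def vec_eq_iff algebra_simps)

lemma momentum_inject [simp]: "momentum a = momentum b \<longleftrightarrow> a = b"
  using I_pos by (auto simp: momentum_def vec_eq_iff) (metis less_irrefl)

lemma linear_Kmap: "linear (Kmap \<gamma>)"
  by (rule linearI) (simp_all add: Kmap_def rolling_part_def vec_eq_iff inner_left_distrib algebra_simps)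

lemma A_gram: "transpose A *v (A *v w) = \<kappa> *\<^sub>R w + (\<epsilon> * (w \<bullet> e3)) *\<^sub>R e3"
  unfolding A_eq by (simp add: \<kappa>_def \<epsilon>_def e3_def axis_def mat3_simps power2_eq_square algebra_simps)

lemma A_gram_body:
  assumes "rotation_matrix g"
  shows "transpose g *v (transpose A *v (A *v (g *v w))) = rolling_part (transpose g *v e3) w"
proof -
  have "(g *v w) \<bullet> e3 = w \<bullet> (transpose g *v e3)" by (rule inner_matrix_vector)
  then show ?thesis
    unfolding A_gram rolling_part_def
    by (simp add: matrix_vector_right_distrib matrix_vector_mult_scaleR rotation_cancel[OF assms])
qed

lemma inner_A_body:
  assumes "rotation_matrix g"
  shows "(A *v (g *v a)) \<bullet> (A *v (g *v b)) = a \<bullet> rolling_part (transpose g *v e3) b"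
  unfolding A_gram_body[OF assms, symmetric] by (simp add: inner_matrix_vector)

lemma constraint_distribution_eq:
  "constraint_distribution r A =
    {((g, x), (g ** hat \<Omega>, r *\<^sub>R (A *v (g *v \<Omega>)))) |g x \<Omega>. rotation_matrix g}"
proof (intro equalityI subsetI)
  fix z assume "z \<in> constraint_distribution r A"
  then obtain g x v where z: "z = ((g, x), v)" and g: "rotation_matrix g"
    and v: "v \<in> tangent_space Q (g, x)" "constraint_form r A (g, x) v = 0"
    by (auto simp: constraint_distribution_def Q_def)
  then obtain b y where b: "v = (g ** hat b, y)" by (auto simp: tangent_space_Q[OF g])
  then have "y = r *\<^sub>R (A *v (g *v b))"
    using v(2) by (simp add: constraint_form_def maurer_cartan_hat[OF g])
  then show "z \<in> {((g, x), (g ** hat \<Omega>, r *\<^sub>R (A *v (g *v \<Omega>)))) |g x \<Omega>. rotation_matrix g}"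
    using z b g by blast
next
  fix z :: phase assume "z \<in> {((g, x), (g ** hat \<Omega>, r *\<^sub>R (A *v (g *v \<Omega>)))) |g x \<Omega>. rotation_matrix g}"
  then show "z \<in> constraint_distribution r A"
    by (auto simp: constraint_distribution_def tangent_space_Q constraint_form_def maurer_cartan_hat)
      (auto simp: Q_def)
qed

lemma legendre_constraint:
  "rotation_matrix g \<Longrightarrow> legendre m I ((g, x), (g ** hat \<Omega>, r *\<^sub>R (A *v (g *v \<Omega>)))) = point g x \<Omega>"
  by (simp add: legendre_eq point_def momentum_def)

lemma M_eq: "M = {point g x \<Omega> |g x \<Omega>. rotation_matrix g}"
proof -
  have "M = {legendre m I ((g, x), (g ** hat \<Omega>, r *\<^sub>R (A *v (g *v \<Omega>)))) |g x \<Omega>. rotation_matrix g}"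
    unfolding constraint_manifold_def constraint_distribution_eq by blast
  then show ?thesis by (simp add: legendre_constraint cong: rev_conj_cong)
qed

lemma point_inject:
  assumes "rotation_matrix g"
  shows "point g x \<Omega> = point g' x' \<Omega>' \<longleftrightarrow> g = g' \<and> x = x' \<and> \<Omega> = \<Omega>'"
proof
  assume eq: "point g x \<Omega> = point g' x' \<Omega>'"
  then have "g = g'" "x = x'" by (auto simp: point_def)
  moreover from this eq have "hat (momentum \<Omega>) = hat (momentum \<Omega>')"
    using rotation_mult_cancel[OF assms] by (auto simp: point_def)
  then have "\<Omega> = \<Omega>'" by (metis vee_hat momentum_inject)
  ultimately show "g = g' \<and> x = x' \<and> \<Omega> = \<Omega>'" by simp
qed simp

text \<open>Gives meaning to the inverse Legendre transform inside \<open>Omega_of\<close>.\<close>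

lemma inj_legendre: "inj_on (legendre m I) (constraint_distribution r A)"
  by (rule inj_onI) (auto simp: constraint_distribution_eq legendre_constraint point_inject)

lemma Omega_of_point:
  assumes g: "rotation_matrix g"
  shows "Omega_of m r I A (point g x \<Omega>) = \<Omega>"
proof -
  let ?v = "((g, x), (g ** hat \<Omega>, r *\<^sub>R (A *v (g *v \<Omega>))))"
  have "?v \<in> constraint_distribution r A"
    using g by (auto simp: constraint_distribution_eq)
  then have "the_inv_into (constraint_distribution r A) (legendre m I) (point g x \<Omega>) = ?v"
    using the_inv_into_f_f[OF inj_legendre] legendre_constraint[OF g] by metis
  then show ?thesis by (simp add: Omega_of_def maurer_cartan_hat[OF g])
qed

lemma K_of_point:
  assumes "rotation_matrix g"
  shows "K_of m r I A (point g x \<Omega>) = Kmap (transpose g *v e3) \<Omega>"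
  by (simp add: K_of_def Let_def Omega_of_point[OF assms] A_gram_body[OF assms] Kmap_def)
    (simp add: point_def A_gram_body[OF assms])

lemma rho_point:
  assumes "rotation_matrix g"
  shows "\<rho> m r I A (point g x \<Omega>) = (transpose g *v e3, Kmap (transpose g *v e3) \<Omega>)"
  by (simp add: \<rho>_def K_of_point[OF assms]) (simp add: point_def)

section \<open>Tangent vectors of the constraint manifold\<close>

text \<open>By the product rule, the moving factor \<open>G\<close> contributes
  \<open>hat b ** hat (momentum \<Omega>)\<close> to the rotational momentum and
  \<open>cross3 b \<Omega>\<close> to the translational one.\<close>

lemma point_curve_deriv:
  assumes G: "(G has_vector_derivative G 0 ** hat b) (at 0)"
    and X: "(X has_vector_derivative y) (at 0)"
    and W: "(W has_vector_derivative w) (at 0)"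
  shows "((\<lambda>t. point (G t) (X t) (W t)) has_vector_derivative velocity (G 0) (W 0) b y w) (at 0)"
proof -
  have "bounded_linear (\<lambda>w. hat (momentum w))"
    using bounded_linear_compose[OF bounded_linear_hat] linear_momentum linear_conv_bounded_linear by blast
  note hm = bounded_linear.has_vector_derivative[OF this W]
  have "bounded_linear (\<lambda>v. (m * r) *\<^sub>R (A *v v))"
    by (intro bounded_linear_scaleR_right[THEN bounded_linear_compose]
      bounded_bilinear.bounded_linear_right[OF bounded_bilinear_matrix_vector])
  note Am = bounded_linear.has_vector_derivative[OF this matrix_vector_deriv[OF G W]]
  show ?thesis
    unfolding point_def
    using has_vector_derivative_Pair[OF has_vector_derivative_Pair[OF G X]
        has_vector_derivative_Pair[OF matrix_mult_deriv[OF G hm] Am]]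
    by (simp add: velocity_def matrix_mul_assoc[symmetric] matrix_vector_mul_assoc[symmetric]
        hat_mult_vector matrix_vector_right_distrib add.commute)
qed

lemma tangent_space_M:
  assumes g: "rotation_matrix g"
  shows "tangent_space M (point g x \<Omega>) = {velocity g \<Omega> b y w |b y w. True}"
proof (intro equalityI subsetI)
  fix v assume "v \<in> tangent_space M (point g x \<Omega>)"
  then obtain c where c: "c 0 = point g x \<Omega>" "\<And>t::real. c t \<in> M" "(c has_vector_derivative v) (at 0)"
    by (auto simp: tangent_space_def)
  have "\<forall>t. \<exists>G X W. rotation_matrix G \<and> c t = point G X W"
    using c(2) unfolding M_eq by blast
  then obtain G X W where rot: "\<And>t. rotation_matrix (G t)" and ct: "\<And>t. c t = point (G t) (X t) (W t)"
    by metis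
  have 0: "G 0 = g" "X 0 = x" "W 0 = \<Omega>"
    using c(1) ct[of 0] point_inject[OF g] by (metis, metis, metis)
  have Gc: "G = (\<lambda>t. fst (fst (c t)))" and Xc: "X = (\<lambda>t. snd (fst (c t)))"
    by (simp_all add: ct point_def)
  have G: "(G has_vector_derivative fst (fst v)) (at 0)" and X: "(X has_vector_derivative snd (fst v)) (at 0)"
    unfolding Gc Xc
    by (intro bounded_linear.has_vector_derivative[OF bounded_linear_fst]
      bounded_linear.has_vector_derivative[OF bounded_linear_snd] c(3))+
  have P: "((\<lambda>t. fst (snd (c t))) has_vector_derivative fst (snd v)) (at 0)"
    by (intro bounded_linear.has_vector_derivative[OF bounded_linear_fst]
      bounded_linear.has_vector_derivative[OF bounded_linear_snd] c(3))
  \<comment> \<open>Only the ambient curve \<open>c\<close> is known to be differentiable. Its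
    coordinate \<open>W\<close> inherits this by being recovered from \<open>c\<close> through a
    linear left inverse of \<open>momentum\<close>.\<close>
  obtain L where L: "linear L" "\<And>w. L (momentum w) = w"
    using linear_injective_left_inverse[OF linear_momentum] by (auto simp: inj_def fun_eq_iff)
  have "bounded_linear (\<lambda>P. L (vee P))"
    using L(1) by (intro bounded_linear_compose[OF _ bounded_linear_vee]) (simp add: linear_conv_bounded_linear)
  note D = bounded_linear.has_vector_derivative[OF this
    matrix_mult_deriv[OF bounded_linear.has_vector_derivative[OF bounded_linear_transpose G] P]]
  have Wc: "W = (\<lambda>t. L (vee (transpose (G t) ** fst (snd (c t)))))"
    by (simp add: ct point_def rotation_cancel[OF rot] L(2))
  obtain w where W: "(W has_vector_derivative w) (at 0)"
    using D unfolding Wc by blast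
  obtain b where b: "fst (fst v) = G 0 ** hat b"
    using tangent_rotation[OF rot G] by blast
  have "(c has_vector_derivative velocity g \<Omega> b (snd (fst v)) w) (at 0)"
    using point_curve_deriv[OF G[unfolded b] X W] by (simp add: ct[abs_def, symmetric] 0 flip: ct)
  then have "v = velocity g \<Omega> b (snd (fst v)) w"
    using c(3) vector_derivative_unique_at by blast
  then show "v \<in> {velocity g \<Omega> b y w |b y w. True}" by blast
next
  fix v assume "v \<in> {velocity g \<Omega> b y w |b y w. True}"
  then obtain b y w where v: "v = velocity g \<Omega> b y w" by auto
  obtain G where G: "\<And>t::real. rotation_matrix (G t)" "G 0 = g"
    "(G has_vector_derivative g ** hat b) (at 0)"
    using rotation_curve[OF g, where b = b] by blast
  have line: "((\<lambda>t. a + t *\<^sub>R y) has_vector_derivative y) (at 0)" for a y :: "real^3"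
    by (auto intro!: derivative_eq_intros)
  have "((\<lambda>t. point (G t) (x + t *\<^sub>R y) (\<Omega> + t *\<^sub>R w)) has_vector_derivative v) (at 0)"
    using point_curve_deriv[OF _ line line, of G b x y \<Omega> w] G by (simp add: v)
  then show "v \<in> tangent_space M (point g x \<Omega>)"
    using G(1,2) unfolding tangent_space_def M_eq
    by (intro CollectI exI[of _ "\<lambda>t. point (G t) (x + t *\<^sub>R y) (\<Omega> + t *\<^sub>R w)"]) auto
qed

lemma constraint_subspace_eq:
  assumes g: "rotation_matrix g"
  shows "constraint_subspace m r I A (point g x \<Omega>)
    = {velocity g \<Omega> b (r *\<^sub>R (A *v (g *v b))) w |b w. True}"
proof -
  have form: "constraint_form r A (fst (point g x \<Omega>)) (fst (velocity g \<Omega> b y w))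
      = y - r *\<^sub>R (A *v (g *v b))" for b y w
    by (simp add: point_def velocity_def constraint_form_def maurer_cartan_hat[OF g])
  have "velocity g \<Omega> b y w \<in> tangent_space M (point g x \<Omega>)" for b y w
    unfolding tangent_space_M[OF g] by blast
  then have "velocity g \<Omega> b y w \<in> constraint_subspace m r I A (point g x \<Omega>) \<longleftrightarrow>
      y = r *\<^sub>R (A *v (g *v b))" for b y w
    unfolding constraint_subspace_def mem_Collect_eq form by simp
  note mem = this
  have sub: "constraint_subspace m r I A (point g x \<Omega>) \<subseteq> {velocity g \<Omega> b y w |b y w. True}"
    unfolding constraint_subspace_def tangent_space_M[OF g] by (rule Collect_restrict)
  show ?thesis
  proof (intro equalityI subsetI)
    fix v assume v: "v \<in> constraint_subspace m r I A (point g x \<Omega>)"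
    then obtain b y w where vel: "v = velocity g \<Omega> b y w" using sub by blast
    with v have "y = r *\<^sub>R (A *v (g *v b))" by (simp only: mem)
    with vel show "v \<in> {velocity g \<Omega> b (r *\<^sub>R (A *v (g *v b))) w |b w. True}" by blast
  next
    fix v assume "v \<in> {velocity g \<Omega> b (r *\<^sub>R (A *v (g *v b))) w |b w. True}"
    then show "v \<in> constraint_subspace m r I A (point g x \<Omega>)" using mem by force
  qed
qed

section \<open>Invertibility of the relation between angular velocity and K\<close>

text \<open>On the unit sphere the rolling part is a sum of \<open>\<kappa>\<close> times a
  Cauchy-Schwarz defect and \<open>s\<^sup>2\<close> times a square, hence nonnegative; the inertia
  part is positive.\<close>

lemma Kmap_pos:
  assumes "norm \<gamma> = 1" and "w \<noteq> 0"
  shows "w \<bullet> Kmap \<gamma> w > 0"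
proof -
  have "(w \<bullet> \<gamma>)\<^sup>2 \<le> w \<bullet> w"
    using Cauchy_Schwarz_ineq[of w \<gamma>] assms(1) by (simp add: norm_eq_1)
  then have "0 \<le> \<kappa> * (w \<bullet> w - (w \<bullet> \<gamma>)\<^sup>2) + s\<^sup>2 * (w \<bullet> \<gamma>)\<^sup>2"
    by (simp add: \<kappa>_def)
  also have "\<dots> = w \<bullet> rolling_part \<gamma> w"
    by (simp add: rolling_part_def \<epsilon>_def inner_right_distrib power2_eq_square algebra_simps)
  finally have "w \<bullet> rolling_part \<gamma> w \<ge> 0" .
  moreover have "w \<bullet> (inertia I *v w) > 0"
  proof -
    obtain i where "w$i \<noteq> 0" using assms(2) by (auto simp: vec_eq_iff)
    then have "0 < (\<Sum>i\<in>UNIV. I$i * (w$i)\<^sup>2)"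
      using I_pos by (intro sum_pos2[of _ i]) (simp_all add: I_pos less_imp_le)
    then show ?thesis by (simp add: inner_vec_def power2_eq_square mult_ac)
  qed
  ultimately show ?thesis
    using m_pos by (simp add: Kmap_def inner_right_distrib add_pos_nonneg)
qed

lemma inj_Kmap:
  assumes "norm \<gamma> = 1" shows "inj (Kmap \<gamma>)"
  unfolding linear_injective_0[OF linear_Kmap] using Kmap_pos[OF assms] by fastforce

lemma surj_Kmap:
  assumes "norm \<gamma> = 1" shows "surj (Kmap \<gamma>)"
  by (simp add: linear_injective_imp_surjective linear_Kmap inj_Kmap assms)

lemma norm_gamma: "rotation_matrix g \<Longrightarrow> norm (transpose g *v e3) = 1"
  by (metis e3_def inner_rotation_vector norm_axis_1 norm_eq_1 rotation_transpose)

section \<open>The canonical form and the gauge form on the constraint subspace\<close>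

text \<open>The translational momenta contribute \<open>cross3 a b \<bullet> \<Omega>\<close> with
  coefficient \<open>m * r\<^sup>2 * \<kappa>\<close> twice: one copy completes \<open>Kmap\<close>,
  the other belongs to the extra rolling part. The \<open>\<epsilon>\<close> parts of these two
  copies cancel against the terms \<open>(\<Omega> \<bullet> \<gamma>) *\<^sub>R \<gamma>'\<close>
  of \<open>Kmap_deriv\<close>.\<close>

lemma canonical_2form_velocity:
  assumes g: "rotation_matrix g"
  defines "\<gamma> \<equiv> transpose g *v e3"
  shows "canonical_2form z (velocity g \<Omega> a (r *\<^sub>R (A *v (g *v a))) w1)
      (velocity g \<Omega> b (r *\<^sub>R (A *v (g *v b))) w2)
    = a \<bullet> Kmap_deriv \<gamma> \<Omega> (cross3 \<gamma> b) w2 - b \<bullet> Kmap_deriv \<gamma> \<Omega> (cross3 \<gamma> a) w1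
      + cross3 a b \<bullet> (Kmap \<gamma> \<Omega> + (m * r\<^sup>2) *\<^sub>R rolling_part \<gamma> \<Omega>)"
proof -
  have hat_part: "hat a \<bullet> (hat b ** hat (momentum \<Omega>)) - hat b \<bullet> (hat a ** hat (momentum \<Omega>))
      = cross3 a b \<bullet> (inertia I *v \<Omega>)"
    unfolding inner_hat_commutator by (simp add: momentum_def inner_commute)
  have hat_mom: "hat a \<bullet> hat (momentum w) = a \<bullet> (inertia I *v w)" for a w
    by (simp add: inner_hat_hat momentum_def)
  have "canonical_2form z (velocity g \<Omega> a (r *\<^sub>R (A *v (g *v a))) w1)
      (velocity g \<Omega> b (r *\<^sub>R (A *v (g *v b))) w2)
    = cross3 a b \<bullet> (inertia I *v \<Omega>) + a \<bullet> (inertia I *v w2) - b \<bullet> (inertia I *v w1)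
      + (m * r\<^sup>2) * (a \<bullet> rolling_part \<gamma> (cross3 b \<Omega> + w2) - b \<bullet> rolling_part \<gamma> (cross3 a \<Omega> + w1))"
    using hat_part unfolding canonical_2form_eq velocity_def hat_mom[symmetric] \<gamma>_def
    by (simp add: inner_right_distrib inner_left_distrib inner_rotation_matrix_mult[OF g]
        inner_A_body[OF g, symmetric] matrix_vector_right_distrib inner_commute power2_eq_square algebra_simps)
  also have "\<dots> = a \<bullet> Kmap_deriv \<gamma> \<Omega> (cross3 \<gamma> b) w2 - b \<bullet> Kmap_deriv \<gamma> \<Omega> (cross3 \<gamma> a) w1
      + cross3 a b \<bullet> (Kmap \<gamma> \<Omega> + (m * r\<^sup>2) *\<^sub>R rolling_part \<gamma> \<Omega>)"
  proof -
    have "a \<bullet> cross3 b \<Omega> = cross3 a b \<bullet> \<Omega>" "b \<bullet> cross3 a \<Omega> = - (cross3 a b \<bullet> \<Omega>)"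
      "\<Omega> \<bullet> cross3 \<gamma> b = cross3 b \<Omega> \<bullet> \<gamma>" "\<Omega> \<bullet> cross3 \<gamma> a = cross3 a \<Omega> \<bullet> \<gamma>"
      "a \<bullet> cross3 \<gamma> b = - (cross3 a b \<bullet> \<gamma>)" "b \<bullet> cross3 \<gamma> a = cross3 a b \<bullet> \<gamma>"
      by (simp_all add: cross3_def inner_vec_def sum_3 algebra_simps)
    then show ?thesis
      unfolding Kmap_deriv_def Kmap_def rolling_part_def inner_add_right inner_add_left
        inner_scaleR_right inner_scaleR_left
      by (simp add: algebra_simps)
  qed
  finally show ?thesis .
qed

text \<open>The minus sign in the definition of \<open>B\<close> cancels the one of the structure
  equation.\<close>

lemma gauge_form_velocity:
  assumes g: "rotation_matrix g"
  shows "gauge_form m r I A (point g x \<Omega>) (velocity g \<Omega>1 a y1 w1) (velocity g \<Omega>2 b y2 w2)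
    = (m * r\<^sup>2) * (\<Omega> \<bullet> cross3 a b)"
  by (simp add: gauge_form_def Omega_of_point[OF g])
    (simp add: point_def velocity_def ext_deriv_maurer_cartan_hat[OF g])

text \<open>\<open>gauge_sharp\<close> ranges over linear covectors; this makes the covector
  \<open>\<beta> - i_X B\<close> one of them.\<close>

lemma linear_gauge_form: "linear (gauge_form m r I A z u)"
  unfolding gauge_form_def ext_deriv_maurer_cartan
  by (rule linearI) (simp_all add: vee_linear_simps matrix_mult_simps inner_right_distrib
      linear_add[OF bounded_linear.linear[OF bounded_linear_transpose]]
      linear_cmul[OF bounded_linear.linear[OF bounded_linear_transpose]]
      inner_diff_right algebra_simps)

text \<open>On the fibre of the constraint subspace, \<open>b\<close> and the velocity of \<open>K\<close> are linear coordinates.\<close>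

lemma constraint_frame:
  fixes x \<Omega> :: "real^3"
  assumes g: "rotation_matrix g"
  defines "\<gamma> \<equiv> transpose g *v e3"
  obtains e :: "(real^3) \<times> (real^3) \<Rightarrow> phase" where "linear e"
    "range e = constraint_subspace m r I A (point g x \<Omega>)"
    "\<And>b k. \<exists>w. e (b, k) = velocity g \<Omega> b (r *\<^sub>R (A *v (g *v b))) w
       \<and> Kmap_deriv \<gamma> \<Omega> (cross3 \<gamma> b) w = k"
proof -
  \<comment> \<open>\<open>\<Phi>\<close> trades the velocity \<open>w\<close> of the angular
    velocity for that of \<open>K\<close>. It is injective because \<open>Kmap \<gamma>\<close> is,
    hence a linear isomorphism, and the frame is \<open>V\<close> read through its inverse.\<close>
  define \<Phi> where "\<Phi> = (\<lambda>(b, w). (b, Kmap_deriv \<gamma> \<Omega> (cross3 \<gamma> b) w))"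
  define V where "V = (\<lambda>(b, w). velocity g \<Omega> b (r *\<^sub>R (A *v (g *v b))) w)"
  have "linear \<Phi>"
    unfolding \<Phi>_def Kmap_deriv_def
    by (rule linearI) (auto simp: linear_add[OF linear_Kmap] linear_cmul[OF linear_Kmap]
        inner_right_distrib cross_add_right cross_mult_right algebra_simps)
  moreover have "inj \<Phi>"
    by (rule injI) (use norm_gamma[OF g] in \<open>auto simp: \<Phi>_def \<gamma>_def Kmap_deriv_def inj_eq[OF inj_Kmap]\<close>)
  ultimately obtain \<Psi> where \<Psi>: "linear \<Psi>" "\<And>u. \<Psi> (\<Phi> u) = u" "\<And>u. \<Phi> (\<Psi> u) = u"
    using linear_injective_isomorphism[of \<Phi>] by auto
  have "linear V"
    unfolding V_def
    by (rule linearI) (auto simp: velocity_def hat_linear_simps matrix_mult_simps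
        linear_add[OF linear_momentum] linear_cmul[OF linear_momentum] cross_add_left cross_mult_left
        matrix_vector_right_distrib matrix_vector_mult_scaleR algebra_simps)
  show ?thesis
  proof
    show "linear (V \<circ> \<Psi>)"
      by (intro linear_compose \<open>linear V\<close> \<Psi>(1))
    have "range (V \<circ> \<Psi>) = range V"
      by (metis \<Psi>(2) fun.set_map surjI)
    then show "range (V \<circ> \<Psi>) = constraint_subspace m r I A (point g x \<Omega>)"
      unfolding constraint_subspace_eq[OF g] V_def by force
    fix b k
    obtain b' w where *: "\<Psi> (b, k) = (b', w)" by fastforce
    then have "\<Phi> (b', w) = (b, k)" using \<Psi>(3) by metis
    then show "\<exists>w. (V \<circ> \<Psi>) (b, k) = velocity g \<Omega> b (r *\<^sub>R (A *v (g *v b))) w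
       \<and> Kmap_deriv \<gamma> \<Omega> (cross3 \<gamma> b) w = k"
      by (intro exI[of _ w]) (auto simp: * V_def \<Phi>_def)
  qed
qed

end

section \<open>Solving the linear equation of a 2-form in the frame\<close>

lemma linear_form_pair:
  fixes \<alpha> :: "'a::euclidean_space \<times> 'b::euclidean_space \<Rightarrow> real"
  assumes "linear \<alpha>"
  obtains p1 q1 where "\<And>b k. \<alpha> (b, k) = p1 \<bullet> b + q1 \<bullet> k"
proof
  show "\<alpha> (b, k) = fst (adjoint \<alpha> 1) \<bullet> b + snd (adjoint \<alpha> 1) \<bullet> k" for b k
    using adjoint_works[OF assms, of "(b, k)" 1] by (simp add: inner_prod_def inner_commute)
qed

text \<open>Nondegeneracy for every \<open>N\<close>: the choice \<open>b = 0\<close> determines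
  \<open>a\<close>, and then \<open>k = 0\<close> determines \<open>h\<close>.\<close>

lemma form_solution:
  fixes N a h p1 q1 :: "real^3"
  shows "(\<forall>b k. a \<bullet> k - b \<bullet> h + cross3 a b \<bullet> N = p1 \<bullet> b + q1 \<bullet> k)
    \<longleftrightarrow> a = q1 \<and> h = cross3 N a - p1" (is "?L \<longleftrightarrow> ?R")
proof
  assume L: ?L
  have "(a - q1) \<bullet> k = 0" for k
    using L[rule_format, of k 0] by (simp add: inner_diff_left)
  then have "a = q1" by (metis inner_eq_zero_iff right_minus_eq)
  moreover have "(h - (cross3 N a - p1)) \<bullet> b = 0" for b
    using L[rule_format, of 0 b] cross3_triple[of a b N]
    by (simp add: inner_diff_left inner_diff_right inner_commute)
  then have "h = cross3 N a - p1" by (metis inner_eq_zero_iff right_minus_eq)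
  ultimately show ?R by simp
next
  assume ?R
  then show ?L
    using cross3_triple[of a _ N] by (simp add: inner_diff_right inner_commute)
qed

subsection \<open>The gauged nonholonomic bracket\<close>

context rolling
begin

text \<open>The canonical form has the vector \<open>N1\<close> in its cross product term; the gauge
  subtracts \<open>(m * r\<^sup>2) *\<^sub>R \<Omega>\<close> from it, which gives \<open>N\<close>.
  The sign of \<open>nh_sharp\<close> accounts for \<open>- q1\<close>.\<close>

lemma nhB_sharp_eq:
  fixes e :: "(real^3) \<times> (real^3) \<Rightarrow> phase" and \<Omega> x :: "real^3"
  assumes g: "rotation_matrix g"
  defines "\<gamma> \<equiv> transpose g *v e3" and "z \<equiv> point g x \<Omega>"
  assumes e: "linear e" "range e = constraint_subspace m r I A z"
    "\<And>b k. \<exists>w. e (b, k) = velocity g \<Omega> b (r *\<^sub>R (A *v (g *v b))) w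
       \<and> Kmap_deriv \<gamma> \<Omega> (cross3 \<gamma> b) w = k"
  assumes \<beta>: "linear \<beta>" "\<And>b k. \<beta> (e (b, k)) = p1 \<bullet> b + q1 \<bullet> k"
  defines "N \<equiv> Kmap \<gamma> \<Omega> + (m * r\<^sup>2) *\<^sub>R (rolling_part \<gamma> \<Omega> - \<Omega>)"
  shows "nhB_sharp m r I A z \<beta> = e (- q1, p1 - cross3 N q1)"
proof -
  let ?C = "constraint_subspace m r I A z" and ?T = "tangent_space M z"
    and ?B = "gauge_form m r I A z"
  define N1 where "N1 = Kmap \<gamma> \<Omega> + (m * r\<^sup>2) *\<^sub>R rolling_part \<gamma> \<Omega>"
  have \<omega>: "canonical_2form z (e (a, h)) (e (b, k)) = a \<bullet> k - b \<bullet> h + cross3 a b \<bullet> N1" for a h b k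
    using e(3)[of a h] e(3)[of b k] canonical_2form_velocity[OF g]
    unfolding N1_def \<gamma>_def by metis
  have B: "?B (e (a, h)) (e (b, k)) = (m * r\<^sup>2) * (\<Omega> \<bullet> cross3 a b)" for a h b k
    using e(3)[of a h] e(3)[of b k] gauge_form_velocity[OF g] unfolding z_def by metis
  have C: "v \<in> ?C \<longleftrightarrow> (\<exists>b k. v = e (b, k))" for v
    using e(2) by (metis rangeE rangeI surj_pair)
  have CT: "?C \<subseteq> ?T" by (auto simp: constraint_subspace_def)
  have em: "- e (a, h) = e (- a, - h)" for a h
    using linear_neg[OF e(1), of "(a, h)"] by simp
  have nh: "nh_sharp m r I A z \<alpha> = e (- q2, p2 - cross3 N1 q2)"
    if \<alpha>: "\<And>b k. \<alpha> (e (b, k)) = p2 \<bullet> b + q2 \<bullet> k" for \<alpha> p2 q2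
  proof -
    have sol: "(\<forall>v\<in>?C. canonical_2form z (e (a, h)) v = \<alpha> v) \<longleftrightarrow> a = q2 \<and> h = cross3 N1 a - p2" for a h
    proof -
      have "(\<forall>v\<in>?C. P v) \<longleftrightarrow> (\<forall>b k. P (e (b, k)))" for P
        by (metis C)
      then show ?thesis
        unfolding form_solution[symmetric] \<omega>[symmetric] \<alpha>[symmetric] .
    qed
    have "(THE X. X \<in> ?C \<and> (\<forall>v\<in>?C. canonical_2form z X v = \<alpha> v)) = e (q2, cross3 N1 q2 - p2)"
    proof (rule the_equality)
      fix X assume X: "X \<in> ?C \<and> (\<forall>v\<in>?C. canonical_2form z X v = \<alpha> v)"
      then obtain a h where "X = e (a, h)" using C by blast
      with X sol show "X = e (q2, cross3 N1 q2 - p2)" by simp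
    qed (use C sol in blast)
    then show ?thesis unfolding nh_sharp_def by (simp add: em)
  qed
  have "(THE X. \<exists>\<alpha>. linear \<alpha> \<and> X = nh_sharp m r I A z \<alpha> \<and> (\<forall>v\<in>?T. \<beta> v = \<alpha> v + ?B X v))
    = e (- q1, p1 - cross3 N q1)" (is "_ = ?X")
  proof (rule the_equality)
    \<comment> \<open>The graph condition dictates this covector. Since \<open>?X\<close> has
      angular part \<open>- q1\<close>, its first coefficient is \<open>p1\<close> shifted by
      \<open>(m * r\<^sup>2) *\<^sub>R cross3 \<Omega> q1\<close>.\<close>
    let ?\<alpha> = "\<lambda>v. \<beta> v - ?B ?X v"
    have "linear ?\<alpha>" by (intro linear_compose_sub \<beta>(1) linear_gauge_form)
    moreover have "?\<alpha> (e (b, k)) = (p1 + (m * r\<^sup>2) *\<^sub>R cross3 \<Omega> q1) \<bullet> b + q1 \<bullet> k" for b k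
      by (simp add: B \<beta>(2)) (simp add: cross3_def inner_vec_def sum_3 algebra_simps)
    then have "nh_sharp m r I A z ?\<alpha> = e (- q1, (p1 + (m * r\<^sup>2) *\<^sub>R cross3 \<Omega> q1) - cross3 N1 q1)"
      by (rule nh)
    then have "?X = nh_sharp m r I A z ?\<alpha>"
      by (simp add: N_def N1_def cross_add_left cross_mult_left Cross3.left_diff_distrib algebra_simps)
    ultimately show "\<exists>\<alpha>. linear \<alpha> \<and> ?X = nh_sharp m r I A z \<alpha> \<and> (\<forall>v\<in>?T. \<beta> v = \<alpha> v + ?B ?X v)"
      by (intro exI[of _ ?\<alpha>]) auto
  next
    \<comment> \<open>Any competitor is a value of \<open>nh_sharp\<close>, hence lies in the
      constraint subspace. Testing the graph condition on the frame alone already fixes the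
      coefficients \<open>p2\<close> and \<open>q2\<close> that determine it.\<close>
    fix X assume "\<exists>\<alpha>. linear \<alpha> \<and> X = nh_sharp m r I A z \<alpha> \<and> (\<forall>v\<in>?T. \<beta> v = \<alpha> v + ?B X v)"
    then obtain \<alpha> where \<alpha>: "linear \<alpha>" "X = nh_sharp m r I A z \<alpha>" "\<And>v. v \<in> ?T \<Longrightarrow> \<beta> v = \<alpha> v + ?B X v"
      by blast
    obtain p2 q2 where pq: "\<And>b k. \<alpha> (e (b, k)) = p2 \<bullet> b + q2 \<bullet> k"
      using linear_form_pair[OF linear_compose[OF e(1) \<alpha>(1)]] by (metis comp_apply)
    have X: "X = e (- q2, p2 - cross3 N1 q2)"
      using \<alpha>(2) nh[of \<alpha>, OF pq] by simp
    have *: "p1 \<bullet> b + q1 \<bullet> k = p2 \<bullet> b + q2 \<bullet> k - (m * r\<^sup>2) * (\<Omega> \<bullet> cross3 q2 b)" for b k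
    proof -
      have "e (b, k) \<in> ?T" using C CT by blast
      from \<alpha>(3)[OF this] show ?thesis by (simp add: \<beta>(2) pq X B)
    qed
    have "(q1 - q2) \<bullet> k = 0" for k
      using *[of 0 k] by (simp add: inner_diff_left)
    then have q: "q1 = q2" by (metis inner_eq_zero_iff right_minus_eq)
    have "(p1 - (p2 - (m * r\<^sup>2) *\<^sub>R cross3 \<Omega> q2)) \<bullet> b = 0" for b
      using *[of b 0] cross3_triple[of q2 b \<Omega>]
      by (simp add: inner_diff_left inner_diff_right inner_commute)
    then have p: "p1 = p2 - (m * r\<^sup>2) *\<^sub>R cross3 \<Omega> q2" by (metis inner_eq_zero_iff right_minus_eq)
    show "X = ?X"
      unfolding X q p
      by (simp add: N_def N1_def cross_add_left cross_mult_left Cross3.left_diff_distrib algebra_simps)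
  qed
  then show ?thesis
    by (simp add: nhB_sharp_def gauge_sharp_def)
qed

text \<open>\<open>Omega_of\<close> is meaningful only on \<open>M\<close>, so \<open>\<rho>\<close>
  is replaced by a map that is differentiable on the whole ambient space and agrees with it on
  \<open>M\<close>; this map can be differentiated by the ordinary rules.\<close>

lemma rho_extension:
  obtains \<rho>' where
    "\<And>w. w \<in> M \<Longrightarrow> \<rho>' w = \<rho> m r I A w"
    "\<And>z. \<exists>D. (\<rho>' has_derivative D) (at z)"
    "\<And>g x \<Omega> D b y w. rotation_matrix g \<Longrightarrow> (\<rho>' has_derivative D) (at (point g x \<Omega>)) \<Longrightarrow>
       D (velocity g \<Omega> b y w) = (let \<gamma> = transpose g *v e3 in
         (cross3 \<gamma> b, Kmap_deriv \<gamma> \<Omega> (cross3 \<gamma> b) w))"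
proof -
  obtain L where L: "linear L" "\<And>w. L (momentum w) = w"
    using linear_injective_left_inverse[OF linear_momentum] by (auto simp: inj_def fun_eq_iff)
  define G where "G = (\<lambda>z :: phase. transpose (fst (fst z)) *v e3)"
  define W where "W = (\<lambda>z :: phase. L (vee (transpose (fst (fst z)) ** fst (snd z))))"
  define \<rho>' where "\<rho>' = (\<lambda>z. (G z, Kmap (G z) (W z)))"
  have G: "bounded_linear G"
    unfolding G_def
    by (intro bounded_linear_compose[OF bounded_bilinear.bounded_linear_left[OF bounded_bilinear_matrix_vector]]
        bounded_linear_compose[OF bounded_linear_transpose] bounded_linear_fst_comp bounded_linear_fst)
  note dG = bounded_linear_imp_has_derivative[OF G]
  have dg: "((\<lambda>z :: phase. transpose (fst (fst z))) has_derivative (\<lambda>u. transpose (fst (fst u)))) (at z)" for z :: phase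
    by (intro bounded_linear_imp_has_derivative bounded_linear_compose[OF bounded_linear_transpose]
        bounded_linear_fst_comp bounded_linear_fst)
  have dp: "((\<lambda>z :: phase. fst (snd z)) has_derivative (\<lambda>u. fst (snd u))) (at z)" for z :: phase
    by (intro bounded_linear_imp_has_derivative bounded_linear_fst_comp bounded_linear_snd)
  have "bounded_linear (\<lambda>P. L (vee P))"
    using L(1) by (intro bounded_linear_compose[OF _ bounded_linear_vee]) (simp add: linear_conv_bounded_linear)
  note dL = bounded_linear.has_derivative[OF this]
  define W' where "W' = (\<lambda>(z :: phase) (u :: phase). L (vee (transpose (fst (fst z)) ** fst (snd u)
      + transpose (fst (fst u)) ** fst (snd z))))"
  have dW: "(W has_derivative W' z) (at z)" for z :: phase
    unfolding W_def W'_def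
    by (rule dL[OF bounded_bilinear.FDERIV[OF bounded_bilinear_matrix_mult dg dp]])
  have lin: "bounded_linear (\<lambda>w. inertia I *v w)"
    by (rule bounded_bilinear.bounded_linear_right[OF bounded_bilinear_matrix_vector])
  have dK: "((\<lambda>z. Kmap (G z) (W z)) has_derivative (\<lambda>u. Kmap_deriv (G z) (W z) (G u) (W' z u))) (at z)" for z
    unfolding Kmap_def Kmap_deriv_def rolling_part_def
    by (rule derivative_eq_intros bounded_linear.has_derivative[OF lin] dG dW refl)+
      (simp add: fun_eq_iff inner_commute algebra_simps)
  have d\<rho>: "(\<rho>' has_derivative (\<lambda>u. (G u, Kmap_deriv (G z) (W z) (G u) (W' z u)))) (at z)" for z
    unfolding \<rho>'_def by (intro has_derivative_Pair dG dK)
  show ?thesis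
  proof
    fix w assume "w \<in> M"
    then obtain g x \<Omega> where w: "w = point g x \<Omega>" and g: "rotation_matrix g"
      unfolding M_eq by blast
    show "\<rho>' w = \<rho> m r I A w"
      unfolding w rho_point[OF g]
      by (simp add: \<rho>'_def G_def W_def point_def rotation_cancel[OF g] L(2))
  next
    show "\<exists>D. (\<rho>' has_derivative D) (at z)" for z :: phase using d\<rho> by blast
  next
    fix g x \<Omega> D b y w
    assume g: "rotation_matrix g" and D: "(\<rho>' has_derivative D) (at (point g x \<Omega>))"
    let ?z = "point g x \<Omega>" and ?v = "velocity g \<Omega> b y w"
    have Deq: "D = (\<lambda>u. (G u, Kmap_deriv (G ?z) (W ?z) (G u) (W' ?z u)))"
      by (rule has_derivative_unique[OF D d\<rho>])
    have Gv: "G ?v = cross3 (transpose g *v e3) b"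
      by (simp add: G_def velocity_def matrix_transpose_mul transpose_hat hat_mult_vector
          matrix_vector_mul_assoc[symmetric] cross_skew[of b] matrix_mult_simps
          bounded_bilinear.minus_left[OF bounded_bilinear_matrix_vector])
    \<comment> \<open>Left trivialisation removes the motion of \<open>g\<close>: the two copies of
      \<open>hat b ** hat (momentum \<Omega>)\<close> cancel since \<open>hat b\<close> is
      skew.\<close>
    have "transpose (fst (fst ?z)) ** fst (snd ?v) + transpose (fst (fst ?v)) ** fst (snd ?z)
        = hat (momentum w)"
      by (simp add: velocity_def point_def matrix_transpose_mul transpose_hat matrix_mult_simps
          matrix_mul_assoc[symmetric] rotation_cancel[OF g])
    then have Wv: "W' ?z ?v = w" by (simp add: W'_def L(2))
    have Wz: "W ?z = \<Omega>" and Gz: "G ?z = transpose g *v e3"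
      by (simp_all add: W_def G_def point_def rotation_cancel[OF g] L(2))
    show "D ?v = (let \<gamma> = transpose g *v e3 in
        (cross3 \<gamma> b, Kmap_deriv \<gamma> \<Omega> (cross3 \<gamma> b) w))"
      unfolding Deq Gv Wv Wz Gz by (simp add: Let_def)
  qed
qed

end

section \<open>Differentials of functions on the constraint manifold\<close>

text \<open>A derivative within \<open>S\<close> need not be unique as an ambient linear map, but
  the chain rule along a curve in \<open>S\<close> fixes its value on the velocity. This makes
  \<open>differential_on\<close> computable.\<close>

lemma derivative_on_tangent_space:
  assumes "v \<in> tangent_space S z"
    and D1: "(f has_derivative D1) (at z within S)" and D2: "(f has_derivative D2) (at z within S)"
  shows "D1 v = D2 v"
proof -
  obtain c where c: "c 0 = z" "\<And>t::real. c t \<in> S" "(c has_vector_derivative v) (at 0)"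
    using assms(1) by (auto simp: tangent_space_def)
  have "((\<lambda>t. f (c t)) has_derivative (\<lambda>t. D (t *\<^sub>R v))) (at 0)"
    if "(f has_derivative D) (at z within S)" for D
  proof (rule has_derivative_in_compose[of c "\<lambda>t. t *\<^sub>R v" 0 UNIV f D])
    show "(c has_derivative (\<lambda>t. t *\<^sub>R v)) (at 0)"
      using c(3) by (simp add: has_vector_derivative_def)
    show "(f has_derivative D) (at (c 0) within range c)"
      unfolding c(1) using that by (rule has_derivative_subset) (use c(2) in blast)
  qed
  from has_derivative_unique[OF this[OF D1] this[OF D2]] show ?thesis
    by (metis scaleR_one)
qed

lemma linear_form_vec:
  fixes l :: "real^'n \<Rightarrow> real"
  assumes "linear l" shows "l c = (\<chi> i. l (axis i 1)) \<bullet> c"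
proof -
  have "l x = adjoint l 1 \<bullet> x" for x
    using adjoint_works[OF assms, of x 1] by (simp add: inner_commute)
  then show ?thesis by (simp add: inner_axis vec_nth_inverse)
qed

lemma smooth_has_derivative:
  assumes "smooth F" shows "(F has_derivative frechet_derivative F (at y)) (at y)"
proof -
  have "Ck (Suc 0) F" using assms smooth_def by blast
  then show ?thesis using frechet_derivative_works by auto
qed

lemma frechet_derivative_gradient:
  assumes "smooth F"
  shows "frechet_derivative F (at (\<gamma>, K)) (c, k) = grad_\<gamma> F (\<gamma>, K) \<bullet> c + grad_K F (\<gamma>, K) \<bullet> k"
proof -
  let ?D = "frechet_derivative F (at (\<gamma>, K))"
  note D = smooth_has_derivative[OF assms, of "(\<gamma>, K)"]
  have lin: "linear ?D" by (rule has_derivative_linear[OF D])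
  have d1: "((\<lambda>\<xi>. F (\<xi>, K)) has_derivative (\<lambda>c. ?D (c, 0))) (at \<gamma>)"
    by (rule has_derivative_compose[OF has_derivative_Pair[OF has_derivative_ident has_derivative_const] D])
  then have "grad_\<gamma> F (\<gamma>, K) = (\<chi> i. ?D (axis i 1, 0))"
    by (simp add: grad_\<gamma>_def frechet_derivative_at[OF d1, symmetric])
  moreover have lin1: "linear (\<lambda>c. ?D (c, 0))"
    using linear_compose[OF _ lin, of "\<lambda>c. (c, 0)"] by (simp add: linear_iff o_def)
  ultimately have 1: "?D (c, 0) = grad_\<gamma> F (\<gamma>, K) \<bullet> c"
    by (metis linear_form_vec[OF lin1])
  have d2: "((\<lambda>\<xi>. F (\<gamma>, \<xi>)) has_derivative (\<lambda>c. ?D (0, c))) (at K)"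
    by (rule has_derivative_compose[OF has_derivative_Pair[OF has_derivative_const has_derivative_ident] D])
  then have "grad_K F (\<gamma>, K) = (\<chi> i. ?D (0, axis i 1))"
    by (simp add: grad_K_def frechet_derivative_at[OF d2, symmetric])
  moreover have lin2: "linear (\<lambda>c. ?D (0, c))"
    using linear_compose[OF _ lin, of "\<lambda>c. (0, c)"] by (simp add: linear_iff o_def)
  ultimately have 2: "?D (0, k) = grad_K F (\<gamma>, K) \<bullet> k"
    by (metis linear_form_vec[OF lin2])
  show ?thesis
    using linear_add[OF lin, of "(c, 0)" "(0, k)"] 1 2 by simp
qed

context rolling
begin

text \<open>In the frame the differential of the pulled-back function has coefficients
  \<open>cross3 (grad_\<gamma> F (\<gamma>, K)) \<gamma>\<close> and
  \<open>grad_K F (\<gamma>, K)\<close>; inserting them into \<open>nhB_sharp_eq\<close> leaves only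
  triple product identities.\<close>

lemma nhB_bracket_eq:
  fixes x \<Omega> :: "real^3"
  assumes g: "rotation_matrix g"
    and F1: "smooth_extension R f1 F1" and F2: "smooth_extension R f2 F2"
  defines "\<gamma> \<equiv> transpose g *v e3"
  defines "K \<equiv> Kmap \<gamma> \<Omega>"
  defines "N \<equiv> K + (m * r\<^sup>2) *\<^sub>R (rolling_part \<gamma> \<Omega> - \<Omega>)"
  shows "nhB_bracket m r I A (f1 \<circ> \<rho> m r I A) (f2 \<circ> \<rho> m r I A) (point g x \<Omega>)
    = - (N \<bullet> cross3 (grad_K F1 (\<gamma>, K)) (grad_K F2 (\<gamma>, K)))
      - \<gamma> \<bullet> (cross3 (grad_K F1 (\<gamma>, K)) (grad_\<gamma> F2 (\<gamma>, K))
             - cross3 (grad_K F2 (\<gamma>, K)) (grad_\<gamma> F1 (\<gamma>, K)))"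
proof -
  let ?z = "point g x \<Omega>"
  have zM: "?z \<in> M" using g unfolding M_eq by blast
  obtain e where e: "linear e" "range e = constraint_subspace m r I A ?z"
    "\<And>b k. \<exists>w. e (b, k) = velocity g \<Omega> b (r *\<^sub>R (A *v (g *v b))) w
       \<and> Kmap_deriv \<gamma> \<Omega> (cross3 \<gamma> b) w = k"
    unfolding \<gamma>_def by (rule constraint_frame[OF g, where x = x and \<Omega> = \<Omega>])
      (rule that[unfolded \<gamma>_def])
  have eT: "e u \<in> tangent_space M ?z" for u
    using e(2) by (auto simp: constraint_subspace_def)
  have differential: "linear (differential_on M (f \<circ> \<rho> m r I A) ?z)
      \<and> (\<forall>b k. differential_on M (f \<circ> \<rho> m r I A) ?z (e (b, k))
          = grad_\<gamma> F (\<gamma>, K) \<bullet> cross3 \<gamma> b + grad_K F (\<gamma>, K) \<bullet> k)"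
    if F: "smooth_extension R f F" for f F
  proof -
    obtain \<rho>' where \<rho>': "\<And>w. w \<in> M \<Longrightarrow> \<rho>' w = \<rho> m r I A w"
      "\<And>z. \<exists>D. (\<rho>' has_derivative D) (at z)"
      "\<And>g x \<Omega> D b y w. rotation_matrix g \<Longrightarrow> (\<rho>' has_derivative D) (at (point g x \<Omega>)) \<Longrightarrow>
       D (velocity g \<Omega> b y w) = (let \<gamma> = transpose g *v e3 in
         (cross3 \<gamma> b, Kmap_deriv \<gamma> \<Omega> (cross3 \<gamma> b) w))"
      using rho_extension by blast
    obtain D where D: "(\<rho>' has_derivative D) (at ?z)" using \<rho>'(2) by blast
    have \<rho>z: "\<rho>' ?z = (\<gamma>, K)"
      by (simp add: \<rho>'(1)[OF zM] rho_point[OF g] \<gamma>_def K_def)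
    have smF: "smooth F" and FR: "\<And>y. y \<in> R \<Longrightarrow> F y = f y"
      using F by (auto simp: smooth_extension_def)
    have comp: "((\<lambda>w. F (\<rho>' w)) has_derivative (\<lambda>u. frechet_derivative F (at (\<gamma>, K)) (D u))) (at ?z within M)"
      using has_derivative_compose[OF has_derivative_at_withinI[OF D] smooth_has_derivative[OF smF]]
      unfolding \<rho>z .
    have ext: "(f \<circ> \<rho> m r I A) w = F (\<rho>' w)" if "w \<in> M" for w
    proof -
      obtain g x \<Omega> where "w = point g x \<Omega>" "rotation_matrix g"
        using \<open>w \<in> M\<close> unfolding M_eq by blast
      then have "\<rho> m r I A w \<in> R" by (simp add: rho_point R_def norm_gamma)
      then show ?thesis by (simp add: \<rho>'(1)[OF that] FR)
    qed
    have dF: "((f \<circ> \<rho> m r I A) has_derivative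
        (\<lambda>u. frechet_derivative F (at (\<gamma>, K)) (D u))) (at ?z within M)"
      by (rule has_derivative_transform[OF zM ext comp])
    \<comment> \<open>The derivative chosen by \<open>differential_on\<close> may differ from the
      one just computed, but both are derivatives within \<open>M\<close> and so agree on the
      frame.\<close>
    then have dd: "((f \<circ> \<rho> m r I A) has_derivative differential_on M (f \<circ> \<rho> m r I A) ?z) (at ?z within M)"
      unfolding differential_on_def using differentiable_def frechet_derivative_works by blast
    have "differential_on M (f \<circ> \<rho> m r I A) ?z (e (b, k))
        = grad_\<gamma> F (\<gamma>, K) \<bullet> cross3 \<gamma> b + grad_K F (\<gamma>, K) \<bullet> k" for b k
    proof -
      have "D (e (b, k)) = (cross3 \<gamma> b, k)"
        using e(3)[of b k] \<rho>'(3)[OF g D] unfolding \<gamma>_def by (metis (no_types, lifting))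
      then show ?thesis
        using derivative_on_tangent_space[OF eT dd dF] frechet_derivative_gradient[OF smF] by simp
    qed
    then show ?thesis using has_derivative_linear[OF dd] by blast
  qed
  let ?d1 = "differential_on M (f1 \<circ> \<rho> m r I A) ?z"
  have "?d1 (e (b, k)) = cross3 (grad_\<gamma> F1 (\<gamma>, K)) \<gamma> \<bullet> b + grad_K F1 (\<gamma>, K) \<bullet> k" for b k
    using differential[OF F1] by (simp add: cross3_triple inner_commute)
  note d1 = this
  have "nhB_sharp m r I A ?z ?d1
      = e (- grad_K F1 (\<gamma>, K), cross3 (grad_\<gamma> F1 (\<gamma>, K)) \<gamma> - cross3 N (grad_K F1 (\<gamma>, K)))"
    unfolding N_def K_def \<gamma>_def
    by (rule nhB_sharp_eq[OF g e(1,2) e(3)[unfolded \<gamma>_def]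
          differential[OF F1, THEN conjunct1] d1[unfolded K_def \<gamma>_def]])
  then show ?thesis
    using differential[OF F2]
    by (simp add: nhB_bracket_def Let_def)
      (simp add: cross3_def inner_vec_def sum_3 algebra_simps)
qed

subsection \<open>Reduction\<close>

text \<open>A rotation fixing \<open>e3\<close> is a planar rotation about that axis, and planar
  rotations commute with the scaled planar rotation in \<open>A\<close>. This is why the symmetry
  group is \<open>H\<close>.\<close>

lemma commutes_with_A:
  fixes h :: "real^3^3"
  assumes h: "rotation_matrix h" and e3: "h *v e3 = e3"
  shows "A *v (h *v w) = h *v (A *v w)"
proof -
  have "transpose h *v e3 = e3"
    using rotation_cancel(3)[OF h, of e3] e3 by simp
  with e3 have z: "h$1$3 = 0" "h$2$3 = 0" "h$3$3 = 1" "h$3$1 = 0" "h$3$2 = 0"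
    by (simp_all add: e3_def axis_def mat3_simps)
  have "transpose h ** h = mat 1" by (rule rotation_transpose_mult[OF h])
  then have "h$1$1 * h$1$1 + h$2$1 * h$2$1 = 1" "h$1$2 * h$1$2 + h$2$2 * h$2$2 = 1"
    by (simp_all add: mat3_simps z)
  moreover have "h$1$1 * h$2$2 - h$1$2 * h$2$1 = 1"
    using h by (simp add: rotation_matrix_def det_3 z)
  \<comment> \<open>The two column norms minus twice the determinant, that is
    \<open>1 + 1 - 2\<close>.\<close>
  ultimately have "(h$1$1 - h$2$2)\<^sup>2 + (h$1$2 + h$2$1)\<^sup>2 = 0"
    by (simp add: power2_eq_square algebra_simps)
  then have "h$1$1 = h$2$2" "h$1$2 = - h$2$1"
    by (simp_all add: sum_power2_eq_zero_iff eq_neg_iff_add_eq_0)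
  then show ?thesis
    unfolding A_eq by (simp add: mat3_simps z algebra_simps)
qed

text \<open>Left translation preserves the body angular velocity, and \<open>h\<close> passes
  through \<open>A\<close> in the translational momentum.\<close>

lemma cotangent_lift_point:
  assumes "rotation_matrix h" and "h *v e3 = e3"
  shows "cotangent_lift (h, y) (point g x \<Omega>) = point (h ** g) (h *v x + y) \<Omega>"
  by (simp add: cotangent_lift_def point_def matrix_mul_assoc matrix_vector_mult_scaleR
      commutes_with_A[OF assms, symmetric] flip: matrix_vector_mul_assoc)

lemma rho_image: "\<rho> m r I A ` M = R"
proof (intro equalityI subsetI)
  fix y assume "y \<in> \<rho> m r I A ` M"
  then show "y \<in> R" unfolding M_eq by (auto simp: rho_point R_def norm_gamma)
next
  fix y assume "y \<in> R"
  then obtain \<gamma> K where y: "y = (\<gamma>, K)" and \<gamma>: "norm \<gamma> = 1" by (auto simp: R_def)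
  \<comment> \<open>The attitude is the transpose of a rotation taking \<open>e3\<close> to
    \<open>\<gamma>\<close>; the position can be anything, here \<open>0\<close>.\<close>
  obtain h where h: "rotation_matrix h" "h *v e3 = \<gamma>"
    using rotation_matrix_exists_basis[of \<gamma> 3] \<gamma> unfolding e3_def by auto
  obtain \<Omega> where "Kmap \<gamma> \<Omega> = K" using surj_Kmap[OF \<gamma>] by (metis surjD)
  then have "\<rho> m r I A (point (transpose h) 0 \<Omega>) = y"
    by (simp add: rho_point rotation_transpose h y)
  moreover have "point (transpose h) 0 \<Omega> \<in> M"
    unfolding M_eq using rotation_transpose[OF h(1)] by blast
  ultimately show "y \<in> \<rho> m r I A ` M" by blast
qed

lemma orbit_projection: "is_orbit_projection m r I A"
proof -
  have "{w \<in> M. \<rho> m r I A w = \<rho> m r I A z} = (\<lambda>h. cotangent_lift h z) ` H" if "z \<in> M" for z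
  proof (intro equalityI subsetI)
    obtain g x \<Omega> where z: "z = point g x \<Omega>" and g: "rotation_matrix g"
      using \<open>z \<in> M\<close> unfolding M_eq by blast
    {
      fix w assume w: "w \<in> {w \<in> M. \<rho> m r I A w = \<rho> m r I A z}"
      then obtain g' x' \<Omega>' where w': "w = point g' x' \<Omega>'" and g': "rotation_matrix g'"
        unfolding M_eq by blast
      have \<gamma>: "transpose g' *v e3 = transpose g *v e3"
        and "Kmap (transpose g *v e3) \<Omega>' = Kmap (transpose g *v e3) \<Omega>"
        using w by (auto simp: w' z rho_point g g')
      then have \<Omega>: "\<Omega>' = \<Omega>" using inj_Kmap[OF norm_gamma[OF g]] by (simp add: inj_eq)
      \<comment> \<open>The only rotation carrying \<open>g\<close> to \<open>g'\<close>. Equality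
        of the two vectors \<open>\<gamma>\<close> says that it fixes \<open>e3\<close>.\<close>
      let ?h = "g' ** transpose g"
      have h: "rotation_matrix ?h" by (intro rotation_mult g' rotation_transpose g)
      have he: "?h *v e3 = e3"
        by (simp add: rotation_cancel[OF g'] flip: matrix_vector_mul_assoc \<gamma>)
      have "w = cotangent_lift (?h, x' - ?h *v x) z"
        unfolding z cotangent_lift_point[OF h he] w' \<Omega>
        by (simp add: rotation_transpose_mult[OF g] flip: matrix_mul_assoc)
      moreover have "(?h, x' - ?h *v x) \<in> H" using h he by (simp add: H_def)
      ultimately show "w \<in> (\<lambda>h. cotangent_lift h z) ` H" by blast
    next
      fix w assume "w \<in> (\<lambda>h. cotangent_lift h z) ` H"
      then obtain h y where h: "rotation_matrix h" "h *v e3 = e3" and w: "w = cotangent_lift (h, y) z"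
        by (auto simp: H_def)
      have hg: "rotation_matrix (h ** g)" by (intro rotation_mult h g)
      have "transpose h *v e3 = e3" using rotation_cancel(3)[OF h(1), of e3] h(2) by simp
      then have \<gamma>: "transpose (h ** g) *v e3 = transpose g *v e3"
        by (simp add: matrix_transpose_mul flip: matrix_vector_mul_assoc)
      have "w = point (h ** g) (h *v x + y) \<Omega>"
        unfolding w z by (rule cotangent_lift_point[OF h])
      moreover from this have "w \<in> M" unfolding M_eq using hg by blast
      ultimately show "w \<in> {w \<in> M. \<rho> m r I A w = \<rho> m r I A z}"
        by (simp add: z rho_point g hg \<gamma>)
    }
  qed
  then show ?thesis unfolding is_orbit_projection_def Let_def using rho_image by blast
qed

section \<open>Comparison with the four brackets indexed by rank\<close>

text \<open>The eigenvalues of \<open>transpose A ** A\<close> are \<open>\<kappa>\<close>, twice,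
  and \<open>s\<^sup>2\<close>. Each is \<open>0\<close> or \<open>1\<close>, so the table is
  \<open>j = 2 * \<kappa> + s\<^sup>2\<close>.\<close>

definition rank_parameters :: "nat \<Rightarrow> bool" where
  "rank_parameters j \<longleftrightarrow> (j, \<kappa>, s\<^sup>2) \<in> {(0, 0, 0), (1, 0, 1), (2, 1, 0), (3, 1, 1)}"

lemma K_relation_eq:
  assumes "rank_parameters j" shows "K_relation m r I j \<gamma> \<Omega> = Kmap \<gamma> \<Omega>"
  using assms
  by (auto simp: rank_parameters_def \<epsilon>_def K_relation_def Kmap_def rolling_part_def
      matrix_vector_mult_add_rdistrib scaleR_matrix_vector_assoc[symmetric] algebra_simps)

lemma Omega_red_eq:
  assumes j: "rank_parameters j" and "norm \<gamma> = 1"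
  shows "Omega_red m r I j \<gamma> (Kmap \<gamma> \<Omega>) = \<Omega>"
  unfolding Omega_red_def K_relation_eq[OF j] inj_eq[OF inj_Kmap[OF assms(2)]] by blast

lemma N'_eq:
  assumes j: "rank_parameters j" and "norm \<gamma> = 1"
  shows "N' m r I j \<gamma> (Kmap \<gamma> \<Omega>) = Kmap \<gamma> \<Omega> + (m * r\<^sup>2) *\<^sub>R (rolling_part \<gamma> \<Omega> - \<Omega>)"
  using j unfolding N'_def Omega_red_eq[OF assms] Let_def
  by (auto simp: rank_parameters_def \<epsilon>_def rolling_part_def algebra_simps)

lemma nhB_bracket_rank_bracket:
  assumes j: "rank_parameters j" and z: "z \<in> M"
    and F1: "smooth_extension R f1 F1" and F2: "smooth_extension R f2 F2"
  shows "nhB_bracket m r I A (f1 \<circ> \<rho> m r I A) (f2 \<circ> \<rho> m r I A) z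
    = rank_bracket m r I j F1 F2 (\<rho> m r I A z)"
proof -
  obtain g x \<Omega> where z: "z = point g x \<Omega>" and g: "rotation_matrix g"
    using z unfolding M_eq by blast
  show ?thesis
    unfolding z nhB_bracket_eq[OF g F1 F2] rho_point[OF g] rank_bracket_def
    by (simp add: N'_eq[OF j norm_gamma[OF g]])
qed

text \<open>The gauged bracket of pulled-back functions depends on \<open>z\<close> only through
  \<open>\<rho>\<close>, whence existence. Surjectivity of \<open>\<rho>\<close> onto
  \<open>R\<close> forces the value at every point.\<close>

lemma reduced_bracket:
  assumes j: "rank_parameters j"
  shows "\<exists>br. is_reduced_bracket m r I A br"
    and "is_reduced_bracket m r I A br \<Longrightarrow> is_restriction_to_R br (rank_bracket m r I j)"
proof -
  \<comment> \<open>The choice of extensions is harmless on \<open>R\<close>: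
    \<open>nhB_bracket_rank_bracket\<close> gives the same value for any of them.\<close>
  let ?br = "\<lambda>f1 f2. rank_bracket m r I j (SOME F. smooth_extension R f1 F) (SOME F. smooth_extension R f2 F)"
  have "smooth_extension R f (SOME F. smooth_extension R f F)" if "smooth_on_submanifold R f" for f
    using that unfolding smooth_on_submanifold_def by (rule someI_ex)
  then have "is_reduced_bracket m r I A ?br"
    unfolding is_reduced_bracket_def using nhB_bracket_rank_bracket[OF j] by metis
  then show "\<exists>br. is_reduced_bracket m r I A br" by blast
next
  assume br: "is_reduced_bracket m r I A br"
  show "is_restriction_to_R br (rank_bracket m r I j)"
    unfolding is_restriction_to_R_def
  proof (intro allI impI ballI)
    fix f1 f2 F1 F2 y
    assume F: "smooth_extension R f1 F1" "smooth_extension R f2 F2" and "y \<in> R"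
    then obtain z where z: "z \<in> M" "y = \<rho> m r I A z" using rho_image by blast
    have "br f1 f2 (\<rho> m r I A z) = nhB_bracket m r I A (f1 \<circ> \<rho> m r I A) (f2 \<circ> \<rho> m r I A) z"
      using br F z(1) unfolding is_reduced_bracket_def smooth_on_submanifold_def by blast
    then show "br f1 f2 y = rank_bracket m r I j F1 F2 y"
      using nhB_bracket_rank_bracket[OF j z(1) F] z(2) by simp
  qed
qed

lemma rank_A:
  assumes "rank_parameters j" shows "rank A = j"
proof -
  have A_mult: "A *v w = vector [p * w$1 - q * w$2, q * w$1 + p * w$2, s * w$3]" for w
    unfolding A_eq by (simp add: mat3_simps)
  consider "j = 0" "\<kappa> = 0" "s\<^sup>2 = 0" | "j = 1" "\<kappa> = 0" "s\<^sup>2 = 1"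
    | "j = 2" "\<kappa> = 1" "s\<^sup>2 = 0" | "j = 3" "\<kappa> = 1" "s\<^sup>2 = 1"
    using assms by (auto simp: rank_parameters_def)
  then show ?thesis
  proof cases
    case 1
    then have "A = 0"
      unfolding A_eq by (auto simp: \<kappa>_def sum_power2_eq_zero_iff vec_eq_iff forall_3)
    then show ?thesis using 1 by simp
  next
    case 2
    then have z: "p = 0" "q = 0" and s: "s * s = 1"
      by (auto simp: \<kappa>_def sum_power2_eq_zero_iff power2_eq_square)
    have "range ((*v) A) = span {e3}"
    proof (intro equalityI subsetI)
      fix v assume "v \<in> range ((*v) A)"
      then obtain w where "v = A *v w" by blast
      then have "v = (s * w$3) *\<^sub>R e3"
        by (simp add: A_mult z e3_def axis_def vec_eq_iff forall_3)
      then show "v \<in> span {e3}" by (auto simp: span_singleton)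
    next
      fix v assume "v \<in> span {e3}"
      then obtain c where "v = c *\<^sub>R e3" by (auto simp: span_singleton)
      \<comment> \<open>As \<open>s * s = 1\<close>, the scalar \<open>s\<close> is its own
        inverse.\<close>
      then have "v = A *v ((s * c) *\<^sub>R e3)"
        using s by (simp add: A_mult z e3_def axis_def vec_eq_iff forall_3 flip: mult.assoc)
      then show "v \<in> range ((*v) A)" by blast
    qed
    moreover have "e3 \<noteq> 0" by (simp add: e3_def axis_eq_0_iff)
    ultimately show ?thesis using 2 by (simp add: rank_dim_range)
  next
    case 3
    then have pq: "p * p + q * q = 1" and z: "s = 0" by (auto simp: \<kappa>_def power2_eq_square)
    have "range ((*v) A) = {v. e3 \<bullet> v = 0}"
    proof (intro equalityI subsetI)
      fix v assume "v \<in> range ((*v) A)"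
      then show "v \<in> {v. e3 \<bullet> v = 0}"
        by (auto simp: A_mult z e3_def inner_axis')
    next
      fix v assume "v \<in> {v. e3 \<bullet> v = 0}"
      then have "v$3 = 0" by (simp add: e3_def inner_axis')
      moreover have "p * (p * v$1 + q * v$2) - q * (p * v$2 - q * v$1) = (p * p + q * q) * v$1"
        "q * (p * v$1 + q * v$2) + p * (p * v$2 - q * v$1) = (p * p + q * q) * v$2"
        by (simp_all add: algebra_simps)
      \<comment> \<open>The preimage is the transpose of the planar rotation applied to
        \<open>v\<close>.\<close>
      ultimately have "v = A *v vector [p * v$1 + q * v$2, p * v$2 - q * v$1, 0]"
        by (simp add: A_mult z vec_eq_iff forall_3 pq)
      then show "v \<in> range ((*v) A)" by blast
    qed
    moreover have "e3 \<in> Basis" by (simp add: e3_def axis_in_Basis_iff)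
    ultimately show ?thesis using 3 by (simp add: rank_dim_range dim_special_hyperplane)
  next
    case 4
    then have "transpose A *v (A *v w) = w" for w
      by (simp add: A_gram \<epsilon>_def)
    then have "inj ((*v) A)" by (metis injI)
    then show ?thesis using 4 by (simp add: full_rank_injective[symmetric])
  qed
qed

end

text \<open>The columns have norm one and the determinant is one, so a sum of two squares vanishes,
  as in \<open>commutes_with_A\<close>.\<close>

lemma rotation_matrix_2:
  fixes C :: "real^2^2" assumes "rotation_matrix C"
  shows "C$2$2 = C$1$1" "C$1$2 = - C$2$1" "(C$1$1)\<^sup>2 + (C$2$1)\<^sup>2 = 1"
proof -
  have "transpose C ** C = mat 1" using assms by (simp add: rotation_matrix_def orthogonal_matrix)
  then have c: "C$1$1 * C$1$1 + C$2$1 * C$2$1 = 1" "C$1$2 * C$1$2 + C$2$2 * C$2$2 = 1"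
    by (simp_all add: vec_eq_iff forall_2 sum_2 matrix_matrix_mult_def transpose_def mat_def)
  moreover have "C$1$1 * C$2$2 - C$1$2 * C$2$1 = 1"
    using assms by (simp add: rotation_matrix_def det_2)
  ultimately have "(C$1$1 - C$2$2)\<^sup>2 + (C$1$2 + C$2$1)\<^sup>2 = 0"
    by (simp add: power2_eq_square algebra_simps)
  then show "C$2$2 = C$1$1" "C$1$2 = - C$2$1"
    by (simp_all add: sum_power2_eq_zero_iff eq_neg_iff_add_eq_0)
  show "(C$1$1)\<^sup>2 + (C$2$1)\<^sup>2 = 1" using c by (simp add: power2_eq_square)
qed

lemma generalized_rolling_normal_form:
  assumes "generalized_rolling A"
  obtains p q s where "A = vector [vector [p, - q, 0], vector [q, p, 0], vector [0, 0, s]]"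
    "(p\<^sup>2 + q\<^sup>2, s\<^sup>2) \<in> {(0, 0), (0, 1), (1, 0), (1, 1)}"
proof -
  consider C where "rotation_matrix C" "A = block_mat C 1"
    | C where "rotation_matrix C" "A = block_mat C 0"
    | "A = (\<chi> i k. e3$i * e3$k)" | "A = 0"
    using assms by (auto simp: generalized_rolling_def)
  then show thesis
  proof cases
    case (1 C)
    show thesis
      by (rule that[of "C$1$1" "C$2$1" 1])
        (simp_all add: 1 block_mat_def rotation_matrix_2)
  next
    case (2 C)
    show thesis
      by (rule that[of "C$1$1" "C$2$1" 0])
        (simp_all add: 2 block_mat_def rotation_matrix_2)
  next
    case 3
    show thesis
      by (rule that[of 0 0 1]) (simp_all add: 3 vec_eq_iff forall_3 e3_def axis_def)
  next
    case 4
    show thesis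
      by (rule that[of 0 0 0]) (simp_all add: 4 vec_eq_iff forall_3)
  qed
qed

text \<open>The gradients are \<open>2 *\<^sub>R \<gamma>\<close> and \<open>0\<close>, and what
  remains is a triple product with \<open>\<gamma>\<close> twice.\<close>

lemma rank_bracket_norm_gamma:
  "rank_bracket m r I j (\<lambda>(\<gamma>, K). (norm \<gamma>)\<^sup>2) F y = 0"
proof -
  obtain \<gamma> K where y: "y = (\<gamma>, K)" by fastforce
  have d: "((\<lambda>\<xi>::real^3. (norm \<xi>)\<^sup>2) has_derivative (\<lambda>h. 2 * (\<gamma> \<bullet> h))) (at \<gamma>)"
    unfolding power2_norm_eq_inner by (auto intro!: derivative_eq_intros simp: inner_commute)
  then have "grad_\<gamma> (\<lambda>(\<gamma>, K). (norm \<gamma>)\<^sup>2) (\<gamma>, K) = 2 *\<^sub>R \<gamma>"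
    by (simp add: grad_\<gamma>_def frechet_derivative_at[OF d, symmetric] inner_axis vec_eq_iff)
  moreover have "grad_K (\<lambda>(\<gamma>, K). (norm \<gamma>)\<^sup>2) (\<gamma>, K) = 0"
    by (simp add: grad_K_def vec_eq_iff)
  ultimately show ?thesis
    by (simp add: y rank_bracket_def cross_mult_right dot_cross_self)
qed

theorem theorem5p4:
  fixes m r :: real and I :: "real^3" and A :: "real^3^3" and j :: nat
  assumes "m > 0" and "r > 0" and "\<forall>i. I$i > 0"
    and "generalized_rolling A" and "rank A = j"
  shows "is_orbit_projection m r I A
       \<and> (\<forall>F y. smooth F \<longrightarrow> rank_bracket m r I j (\<lambda>(\<gamma>, K). (norm \<gamma>)\<^sup>2) F y = 0)
       \<and> (\<exists>br. is_reduced_bracket m r I A br)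
       \<and> (\<forall>br. is_reduced_bracket m r I A br \<longrightarrow>
              is_restriction_to_R br (rank_bracket m r I j))"
proof -
  obtain p q s where A: "A = vector [vector [p, - q, 0], vector [q, p, 0], vector [0, 0, s]]"
    and pqs: "(p\<^sup>2 + q\<^sup>2, s\<^sup>2) \<in> {(0, 0), (0, 1), (1, 0), (1, 1)}"
    using generalized_rolling_normal_form[OF assms(4)] by metis
  interpret rolling m r I A p q s
    by unfold_locales (use assms(1-3) A in auto)
  \<comment> \<open>The normal form yields parameters for some rank \<open>k\<close>, and
    \<open>rank_A\<close> identifies \<open>k\<close> with the given \<open>j\<close>.\<close>
  have "\<exists>k. rank_parameters k"
    using pqs unfolding rank_parameters_def \<kappa>_def[symmetric] by auto
  then have "rank_parameters j"
    using rank_A assms(5) by metis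
  then show ?thesis
    using orbit_projection reduced_bracket rank_bracket_norm_gamma by blast
qed

end
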